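(* Let $M,N\ge1$ be integers, $\beta_{\mathrm d},\beta_{\mathrm{br}},\beta_{\mathrm{ru}},\bar\tau>0$, and let $\mathrm{SNR}$ be the optimal uplink SNR of the RIS-aided link defined in the context, with UE-BS correlation matrix $\mathbf R_{\mathrm d}$ and with UE-RIS correlation matrix given by the exponential decay model $(\mathbf R_{\mathrm{ru}})_{ik}=\rho_{\mathrm{ru}}^{d_{i,k}/d_{\mathrm r}}$, $0\le\rho_{\mathrm{ru}}\le1$. Let $A=\lVert\mathbf R_{\mathrm d}^{1/2}\mathbf a_{\mathrm b}\rVert_2$, $\rho_{ij}=(\mathbf R_{\mathrm{ru}})_{ij}$ and $$F=\sum_{i=1}^{N}\sum_{\substack{j=1\\ j\ne i}}^{N}\frac{\pi}{4}\left(1-|\rho_{ij}|^2\right)^2\,{}_2F_1\!\left(\tfrac32,\tfrac32;1;|\rho_{ij}|^2\right).$$ Then $F$ is monotonically increasing in $\rho_{\mathrm{ru}}$ (non-decreasing), and $$N(N-1)\frac{\pi}{4}\le F\le N(N-1),$$ the lower bound being the value of $F$ at $\rho_{\mathrm{ru}}=0$ and the upper bound its limit as $\rho_{\mathrm{ru}}\to1$. Consequently, $\mathbb E\{\mathrm{SNR}\}_{\mathrm{LB}}\le\mathbb E\{\mathrm{SNR}\}\le\mathbb E\{\mathrm{SNR}\}_{\mathrm{UB}}$, where $$\mathbb E\{\mathrm{SNR}\}_{\mathrm{LB}}=\left(\beta_{\mathrm d}M+\frac{NA\pi}{2}\sqrt{\beta_{\mathrm d}\beta_{\mathrm{br}}\beta_{\mathrm{ru}}}+\beta_{\mathrm{br}}\beta_{\mathrm{ru}}M\Big(N+N(N-1)\frac{\pi}{4}\Big)\right)\bar\tau,$$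 $$\mathbb E\{\mathrm{SNR}\}_{\mathrm{UB}}=\left(\beta_{\mathrm d}M+\frac{NA\pi}{2}\sqrt{\beta_{\mathrm d}\beta_{\mathrm{br}}\beta_{\mathrm{ru}}}+\beta_{\mathrm{br}}\beta_{\mathrm{ru}}MN^2\right)\bar\tau.$$
   Context: Channel model. $\mathbf R_{\mathrm d}\in\mathbb C^{M\times M}$ is a correlation matrix (Hermitian positive semidefinite with unit diagonal). The RIS elements are $N$ distinct points; $d_{i,k}$ is the (Euclidean) distance between the $i$th and $k$th RIS elements and $d_{\mathrm r}>0$ is the nearest-neighbour RIS element separation; $\rho_{\mathrm{ru}}$ is the nearest-neighbour RIS element correlation, and for $\rho_{\mathrm{ru}}=0$ one takes $\mathbf R_{\mathrm{ru}}=\mathbf I_N$. $\mathbf R^{1/2}$ denotes the Hermitian positive semidefinite square root. $\mathbf u_{\mathrm d}\sim\mathcal{CN}(\mathbf 0,\mathbf I_M)$ and $\mathbf u_{\mathrm{ru}}\sim\mathcal{CN}(\mathbf 0,\mathbf I_N)$ are independent standard circularly symmetric complex Gaussian vectors (each entry has $\mathbb E|u|^2=1$). The UE-BS channel is $\mathbf h_{\mathrm d}=\sqrt{\beta_{\mathrm d}}\,\mathbf R_{\mathrm d}^{1/2}\mathbf u_{\mathrm d}$; the UE-RIS channel is $\mathbf h_{\mathrm{ru}}=\sqrt{\beta_{\mathrm{ru}}}\,\tilde{\mathbf h}_{\mathrm{ru}}$ with $\tilde{\mathbf h}_{\mathrm{ru}}=\mathbf R_{\mathrm{ru}}^{1/2}\mathbf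 u_{\mathrm{ru}}$. The RIS-BS channel is $\mathbf H_{\mathrm{br}}=\sqrt{\beta_{\mathrm{br}}}\,\mathbf a_{\mathrm b}\mathbf a_{\mathrm r}^H$, where the steering vectors $\mathbf a_{\mathrm b}\in\mathbb C^M$, $\mathbf a_{\mathrm r}\in\mathbb C^N$ are deterministic with all entries of modulus 1. It is assumed that $\mathbf R_{\mathrm d}^{1/2}\mathbf a_{\mathrm b}\neq\mathbf 0$. Optimal SNR. The global uplink channel is $\mathbf h=\mathbf h_{\mathrm d}+\mathbf H_{\mathrm{br}}\boldsymbol\Phi\mathbf h_{\mathrm{ru}}$ with the SNR-maximising RIS phase matrix $$\boldsymbol\Phi=\psi\,\mathrm{diag}\{e^{j\angle\mathbf a_{\mathrm r}}\}\,\mathrm{diag}\{e^{-j\angle\mathbf h_{\mathrm{ru}}}\},\qquad \psi=\frac{\mathbf a_{\mathrm b}^H\mathbf h_{\mathrm d}}{|\mathbf a_{\mathrm b}^H\mathbf h_{\mathrm d}|},$$ where angles and exponentials of vectors are taken entrywise. Hence $\mathbf h=\mathbf h_{\mathrm d}+\alpha\,\mathbf a_{\mathrm b}$ with $\alpha=\sqrt{\beta_{\mathrm{br}}\beta_{\mathrm{ru}}}\,\psi\,\sum_{n=1}^N|\tilde h_{\mathrm{ru},n}|$, and the optimal uplink SNR is $\mathrm{SNR}=\mathbf h^H\mathbf h\,\bar\tau$. ${}_2F_1$ is the Gaussian hypergeometric function; when $|\rho_{ij}|=1$, the expression $(1-x)^2{}_2F_1(\frac32,\frac32;1;x)$ at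 $x=1$ is understood as its limit as $x\to1^-$. *)

theory Defs
  imports "HOL-Probability.Probability"
begin

unbundle no fps_syntax and no inner_syntax

text \<open>The Hermitian product \<open>x\<^sup>H y\<close>, conjugate-linear in the first argument.\<close>

definition herm_prod :: "complex ^ 'n \<Rightarrow> complex ^ 'n \<Rightarrow> complex" where
  "herm_prod x y = (\<Sum>i\<in>UNIV. cnj (x $ i) * y $ i)"

text \<open>Real parts are taken because \<open>x\<^sup>H A x\<close> has type complex; it is real for Hermitian \<open>A\<close>.\<close>

definition herm_psd :: "complex ^ 'n ^ 'n \<Rightarrow> bool" where
  "herm_psd A \<longleftrightarrow> (\<forall>i j. A $ i $ j = cnj (A $ j $ i)) \<and> (\<forall>x. 0 \<le> Re (herm_prod x (A *v x)))"

definition psd_sqrt :: "complex ^ 'n ^ 'n \<Rightarrow> complex ^ 'n ^ 'n" where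
  "psd_sqrt A = (THE S. herm_psd S \<and> S ** S = A)"

definition correlation_matrix :: "complex ^ 'n ^ 'n \<Rightarrow> bool" where
  "correlation_matrix A \<longleftrightarrow> herm_psd A \<and> (\<forall>i. A $ i $ i = 1)"

definition diag_mat :: "complex ^ 'n \<Rightarrow> complex ^ 'n ^ 'n" where
  "diag_mat v = (\<chi> i j. if i = j then v $ i else 0)"

text \<open>The law \<open>CN(0, I)\<close>, by its density \<open>\<pi>\<^sup>-\<^sup>n exp (- z\<^sup>H z)\<close> with respect to Lebesgue measure on
  the complex space of dimension \<open>n\<close>, viewed as a real space of dimension \<open>2 n\<close>.\<close>

definition std_complex_gaussian :: "'w measure \<Rightarrow> ('w \<Rightarrow> complex ^ 'n) \<Rightarrow> bool" where
  "std_complex_gaussian P u \<longleftrightarrow>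
     distributed P lborel u (\<lambda>z. ennreal (exp (- (norm z)\<^sup>2) / pi ^ CARD('n)))"

text \<open>Independence of two random vectors as independence of the events they generate. The library's
  \<open>indep_var\<close> would force both vectors to have the same type, that is the same dimension.\<close>

definition indep_vectors :: "'w measure \<Rightarrow> ('w \<Rightarrow> complex ^ 'm) \<Rightarrow> ('w \<Rightarrow> complex ^ 'n) \<Rightarrow> bool" where
  "indep_vectors P u v \<longleftrightarrow>
     prob_space.indep_set P {u -` B \<inter> space P | B. B \<in> sets borel}
                            {v -` B \<inter> space P | B. B \<in> sets borel}"

text \<open>For a single element there is no neighbour, and the separation is an arbitrary positive number.\<close>

definition nn_separation :: "('n::finite \<Rightarrow> 'e::euclidean_space) \<Rightarrow> real \<Rightarrow> bool" where
  "nn_separation p dr \<longleftrightarrow>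
     0 < dr \<and> (CARD('n) > 1 \<longrightarrow> dr = Min {dist (p i) (p k) | i k. i \<noteq> k})"

text \<open>The case \<open>\<rho> = 0\<close> is separate because \<open>0 powr 0 = 0\<close> in HOL.\<close>

definition R_ru :: "('n::finite \<Rightarrow> 'e::euclidean_space) \<Rightarrow> real \<Rightarrow> real \<Rightarrow> complex ^ 'n ^ 'n" where
  "R_ru p dr \<rho> =
     (if \<rho> = 0 then mat 1 else (\<chi> i k. complex_of_real (\<rho> powr (dist (p i) (p k) / dr))))"

definition hyp2F1 :: "real \<Rightarrow> real \<Rightarrow> real \<Rightarrow> real \<Rightarrow> real" where
  "hyp2F1 a b c x = eval_fps (fps_hypergeo [a, b] [c] 1) x"

definition hyp_term :: "real \<Rightarrow> real" where
  "hyp_term x =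
     (let g = (\<lambda>y. (1 - y)\<^sup>2 * hyp2F1 (3/2) (3/2) 1 y) in if x = 1 then Lim (at_left 1) g else g x)"

definition F_sum :: "('n::finite \<Rightarrow> 'e::euclidean_space) \<Rightarrow> real \<Rightarrow> real \<Rightarrow> real" where
  "F_sum p dr \<rho> =
     (\<Sum>i\<in>UNIV. \<Sum>j\<in>UNIV - {i}. pi / 4 * hyp_term ((cmod (R_ru p dr \<rho> $ i $ j))\<^sup>2))"

definition h_d :: "real \<Rightarrow> complex ^ 'm ^ 'm \<Rightarrow> complex ^ 'm \<Rightarrow> complex ^ 'm" where
  "h_d \<beta>d Rd ud = sqrt \<beta>d *\<^sub>R (psd_sqrt Rd *v ud)"

definition h_ru :: "real \<Rightarrow> complex ^ 'n ^ 'n \<Rightarrow> complex ^ 'n \<Rightarrow> complex ^ 'n" where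
  "h_ru \<beta>ru Rru uru = sqrt \<beta>ru *\<^sub>R (psd_sqrt Rru *v uru)"

definition H_br :: "real \<Rightarrow> complex ^ 'm \<Rightarrow> complex ^ 'n \<Rightarrow> complex ^ 'n ^ 'm" where
  "H_br \<beta>br ab ar = sqrt \<beta>br *\<^sub>R (\<chi> i k. ab $ i * cnj (ar $ k))"

text \<open>On the null event \<open>ab\<^sup>H xd = 0\<close> the phase \<open>\<psi>\<close> is \<open>0\<close>, by the convention for division by zero.\<close>

definition phase_opt :: "complex ^ 'm \<Rightarrow> complex ^ 'm \<Rightarrow> complex" where
  "phase_opt ab xd = herm_prod ab xd / complex_of_real (cmod (herm_prod ab xd))"

definition RIS_phase ::
  "complex ^ 'm \<Rightarrow> complex ^ 'n \<Rightarrow> complex ^ 'm \<Rightarrow> complex ^ 'n \<Rightarrow> complex ^ 'n ^ 'n" where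
  "RIS_phase ab ar xd xru =
     mat (phase_opt ab xd) ** diag_mat (\<chi> n. cis (Arg (ar $ n))) ** diag_mat (\<chi> n. cis (- Arg (xru $ n)))"

definition global_channel ::
  "real \<Rightarrow> complex ^ 'm \<Rightarrow> complex ^ 'n \<Rightarrow> complex ^ 'm \<Rightarrow> complex ^ 'n \<Rightarrow> complex ^ 'm" where
  "global_channel \<beta>br ab ar xd xru =
     xd + H_br \<beta>br ab ar *v (RIS_phase ab ar xd xru *v xru)"

definition optimal_SNR ::
  "real \<Rightarrow> real \<Rightarrow> real \<Rightarrow> real \<Rightarrow> complex ^ 'm ^ 'm \<Rightarrow> complex ^ 'n ^ 'n \<Rightarrow>
   complex ^ 'm \<Rightarrow> complex ^ 'n \<Rightarrow> complex ^ 'm \<Rightarrow> complex ^ 'n \<Rightarrow> real" where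
  "optimal_SNR \<beta>d \<beta>br \<beta>ru \<tau> Rd Rru ab ar ud uru =
     (let h = global_channel \<beta>br ab ar (h_d \<beta>d Rd ud) (h_ru \<beta>ru Rru uru)
      in Re (herm_prod h h) * \<tau>)"

end

theory Submission
  imports Defs "HOL-Real_Asymp.Real_Asymp"
begin

text \<open>Euler's transformation turns \<open>(1 - x)\<^sup>2 F(3/2, 3/2; 1; x)\<close> into the power series
  \<open>F(-1/2, -1/2; 1; x)\<close>, whose coefficients are squares. It therefore increases from 1 at \<open>x = 0\<close> to its
  coefficient sum \<open>4/\<pi>\<close> at \<open>x = 1\<close>, which gives all claims about \<open>F\<close>.

  The exponential decay matrix is positive semidefinite because distances are conditionally negative
  definite (Schoenberg), so its square root has unit rows and each entry of the UE-RIS channel is a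
  standard complex Gaussian. Almost surely \<open>|h|\<^sup>2\<close> is the sum of \<open>|h\<^sub>d|\<^sup>2\<close>, a cross term that factorises
  by independence, and \<open>\<beta> M (\<Sum> |h\<^sub>n|)\<^sup>2\<close>. The mean of the last term is not computed: \<open>E |h\<^sub>i| |h\<^sub>j| \<le> 1\<close>
  by AM-GM, and \<open>E |h\<^sub>i| |h\<^sub>j| \<ge> E |h\<^sub>i| E |h\<^sub>j| = \<pi>/4\<close> because the conditional mean of \<open>|h\<^sub>j|\<close> given \<open>h\<^sub>i\<close> is
  an increasing function of \<open>|h\<^sub>i|\<close>.\<close>

section \<open>Euler's transformation of the hypergeometric term\<close>

text \<open>The summand of F is a closed form of \<open>E |h_i| |h_j|\<close>, but establishing it
  would require the joint law of two correlated Rayleigh moduli. The argument avoids that law, so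
  the claims about F and the bounds on the mean SNR are proved side by side. They meet only in their
  constants: \<open>pi/4 = (sqrt pi / 2)^2\<close> is the square of \<open>E |z|\<close>, and 1 is
  \<open>E |z|^2\<close>, for a standard complex Gaussian z. Two features of the model shape the
  rest. First, \<open>psd_sqrt\<close> is a definite description, so nothing is known about it until
  existence and uniqueness of the root are proved; for the UE-RIS matrix this presupposes positive
  semidefiniteness, which the decay model does not make visible. Second, the Gaussian vectors are
  given by a density on the whole space, so laws of projections and conditional means have to be
  extracted from invariance under linear isometries.\<close>

lemma pochhammer_three_halves_asymp:
  "(\<lambda>n. pochhammer (3/2::real) n / fact n / sqrt (real n)) \<longlonglongrightarrow> 2 / sqrt pi"
proof -
  have G: "Gamma (3/2::real) = sqrt pi / 2"
    using Gamma_plus1[of "1/2::real"] nonpos_Ints_nonpos[of "1/2::real"]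
    by (auto simp: Gamma_one_half_real)
  have "rGamma_series (3/2::real) \<longlonglongrightarrow> 2 / sqrt pi"
    using rGamma_series_LIMSEQ[of "3/2::real"] by (simp add: rGamma_inverse_Gamma G)
  \<comment> \<open>\<open>rGamma_series\<close> carries \<open>pochhammer (3/2) (Suc n)\<close>
    over \<open>n powr (3/2)\<close>. This quotient removes the surplus last factor and lowers the
    power to \<open>sqrt n\<close>.\<close>
  moreover have "(\<lambda>n. real n / (real n + 3/2)) \<longlonglongrightarrow> 1"
    by real_asymp
  ultimately have "(\<lambda>n. rGamma_series (3/2::real) n * (real n / (real n + 3/2))) \<longlonglongrightarrow> 2 / sqrt pi * 1"
    by (rule tendsto_mult)
  moreover have "\<forall>\<^sub>F n in sequentially. rGamma_series (3/2::real) n * (real n / (real n + 3/2))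
      = pochhammer (3/2::real) n / fact n / sqrt (real n)"
    using eventually_gt_at_top[of "0::nat"]
  proof eventually_elim
    case (elim n)
    have "exp (3/2 * ln (real n)) = real n powr (1 + 1/2)"
      using elim by (simp add: powr_def)
    also have "\<dots> = real n * sqrt (real n)"
      using elim by (simp only: powr_add powr_half_sqrt) simp
    finally show ?case
      using elim by (simp add: rGamma_series_def pochhammer_Suc divide_simps)
  qed
  ultimately show ?thesis
    by (simp add: tendsto_cong)
qed

section \<open>Coefficients of the two hypergeometric series\<close>

lemma pochhammer_div_fact_Suc:
  "pochhammer a (Suc n) / fact (Suc n) = pochhammer a n / fact n * ((real n + a) / (real n + 1))"
  by (simp add: pochhammer_Suc field_simps)

text \<open>The coefficients of \<open>F(-1/2, -1/2; 1; x)\<close>. The lower parameter 1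
  contributes a second factorial, which completes the square.\<close>

definition euler_coeff :: "nat \<Rightarrow> real" where
  "euler_coeff n = (pochhammer (-1/2) n / fact n)\<^sup>2"

definition three_halves_coeff :: "nat \<Rightarrow> real" where
  "three_halves_coeff n = (pochhammer (3/2) n / fact n)\<^sup>2"

lemma three_halves_coeff_Suc:
  "three_halves_coeff (Suc n) = three_halves_coeff n * ((real n + 3/2) / (real n + 1))\<^sup>2"
  by (simp only: three_halves_coeff_def pochhammer_div_fact_Suc power_mult_distrib)

lemma euler_coeff_Suc:
  "euler_coeff (Suc n) = euler_coeff n * ((real n - 1/2) / (real n + 1))\<^sup>2"
  by (simp only: euler_coeff_def pochhammer_div_fact_Suc power_mult_distrib) simp

text \<open>Shifting the argument by 2 gives \<open>(3/2)_n = (1 - 4 n^2) (-1/2)_n\<close>. With a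
  common factor extracted, the second-difference identity becomes an identity of rational functions
  of n.\<close>

lemma three_halves_coeff_eq: "three_halves_coeff n = (4 * (real n)\<^sup>2 - 1)\<^sup>2 * euler_coeff n"
proof (induction n)
  case 0
  then show ?case by (simp add: three_halves_coeff_def euler_coeff_def)
next
  case (Suc n)
  show ?case
    unfolding three_halves_coeff_Suc euler_coeff_Suc Suc.IH
    by (simp add: divide_simps) (simp add: algebra_simps power2_eq_square)
qed

text \<open>Euler's transformation \<open>(1 - x)\<^sup>2 F(3/2, 3/2; 1; x) = F(-1/2, -1/2; 1; x)\<close> says that the
  coefficients on the right are the second differences of those on the left.\<close>

lemma euler_coeff_second_difference:
  "euler_coeff (Suc (Suc n)) =
     three_halves_coeff (Suc (Suc n)) - 2 * three_halves_coeff (Suc n) + three_halves_coeff n"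
proof -
  define t where "t = real n"
  have t: "t \<ge> 0" by (simp add: t_def)
  have 1: "euler_coeff (Suc (Suc n)) = euler_coeff n * ((t - 1/2) / (t + 1))\<^sup>2 * ((t + 1/2) / (t + 2))\<^sup>2"
    unfolding euler_coeff_Suc by (simp add: t_def) (simp add: algebra_simps)
  have 2: "three_halves_coeff n = (4 * t\<^sup>2 - 1)\<^sup>2 * euler_coeff n"
    by (simp add: t_def three_halves_coeff_eq)
  have 3: "three_halves_coeff (Suc n) = three_halves_coeff n * ((t + 3/2) / (t + 1))\<^sup>2"
    by (simp add: t_def three_halves_coeff_Suc)
  have 4: "three_halves_coeff (Suc (Suc n)) = three_halves_coeff (Suc n) * ((t + 5/2) / (t + 2))\<^sup>2"
    by (simp add: t_def three_halves_coeff_Suc[of "Suc n"] add.commute)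
  show ?thesis
    unfolding 4 3 1 2 using t
    by (simp add: divide_simps power_divide) (simp add: algebra_simps power2_eq_square)
qed

text \<open>Dividing a power series by \<open>1 - x\<close> sums its coefficients, so one of the two
  factors \<open>1 - x\<close> in Euler's transformation cancels and a first difference remains. The
  sum runs over the indices 0 to n + 1.\<close>

lemma sum_euler_coeff:
  "(\<Sum>k<Suc (Suc n). euler_coeff k) = three_halves_coeff (Suc n) - three_halves_coeff n"
proof (induction n)
  case 0
  then show ?case by (simp add: euler_coeff_def three_halves_coeff_def power2_eq_square)
next
  case (Suc n)
  then show ?case
    using euler_coeff_second_difference[of n] by simp
qed

text \<open>The partial sums are increments of \<open>three_halves_coeff\<close>, which grows like
  \<open>4 n / pi\<close> with relative increment asymptotic to \<open>1/n\<close>. The result is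
  Gauss's value \<open>Gamma 1 * Gamma 2 / (Gamma (3/2))^2\<close>.\<close>

lemma euler_coeff_sums: "euler_coeff sums (4 / pi)"
proof -
  have "(\<lambda>n. (pochhammer (3/2::real) n / fact n / sqrt (real n))\<^sup>2) \<longlonglongrightarrow> (2 / sqrt pi)\<^sup>2"
    by (intro tendsto_power pochhammer_three_halves_asymp)
  then have "(\<lambda>n. three_halves_coeff n / real n) \<longlonglongrightarrow> 4 / pi"
    by (simp add: three_halves_coeff_def power_divide power_mult_distrib)
  moreover have "(\<lambda>n. real n * (((real n + 3/2) / (real n + 1))\<^sup>2 - 1)) \<longlonglongrightarrow> 1"
    by real_asymp
  ultimately have "(\<lambda>n. three_halves_coeff n / real n * (real n * (((real n + 3/2) / (real n + 1))\<^sup>2 - 1)))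
      \<longlonglongrightarrow> 4 / pi * 1"
    by (rule tendsto_mult)
  moreover have "\<forall>\<^sub>F n in sequentially.
      three_halves_coeff n / real n * (real n * (((real n + 3/2) / (real n + 1))\<^sup>2 - 1))
      = (\<Sum>k<n + 2. euler_coeff k)"
    using eventually_gt_at_top[of "0::nat"]
    by eventually_elim (simp add: sum_euler_coeff three_halves_coeff_Suc algebra_simps del: sum.lessThan_Suc)
  ultimately have "(\<lambda>n. \<Sum>k<n + 2. euler_coeff k) \<longlonglongrightarrow> 4 / pi"
    by (simp add: tendsto_cong)
  then show ?thesis
    unfolding sums_def by (rule LIMSEQ_offset)
qed

lemma euler_coeff_nonneg: "0 \<le> euler_coeff n"
  by (simp add: euler_coeff_def)

section \<open>The transformed series on the closed unit interval\<close>

definition euler_series :: "real \<Rightarrow> real" where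
  "euler_series x = (\<Sum>n. euler_coeff n * x ^ n)"

lemma euler_series_summable:
  assumes "0 \<le> x" "x \<le> 1"
  shows "summable (\<lambda>n. euler_coeff n * x ^ n)"
proof (rule summable_comparison_test')
  show "summable euler_coeff" using euler_coeff_sums by (rule sums_summable)
  show "norm (euler_coeff n * x ^ n) \<le> euler_coeff n" if "0 \<le> n" for n
    using assms by (simp add: euler_coeff_nonneg mult_left_le power_le_one)
qed

lemma euler_series_mono:
  assumes "0 \<le> x" "x \<le> y" "y \<le> 1"
  shows "euler_series x \<le> euler_series y"
  unfolding euler_series_def
  using assms
  by (intro suminf_le mult_left_mono power_mono euler_series_summable euler_coeff_nonneg) auto

lemma euler_series_0: "euler_series 0 = 1"
proof -
  have "euler_series 0 = euler_coeff 0"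
    unfolding euler_series_def by (rule powser_zero)
  then show ?thesis by (simp add: euler_coeff_def)
qed

lemma euler_series_1: "euler_series 1 = 4 / pi"
  using euler_coeff_sums by (simp add: euler_series_def sums_iff)

text \<open>Continuity up to the endpoint gives both the conventional value of
  \<open>hyp_term\<close> at 1 and the limit of F. The coefficients themselves serve as majorants,
  being summable.\<close>

lemma continuous_on_euler_series: "continuous_on {0..1} euler_series"
proof -
  have "uniform_limit {0..1} (\<lambda>n x. \<Sum>i<n. euler_coeff i * x ^ i) (\<lambda>x. \<Sum>i. euler_coeff i * x ^ i)
      sequentially"
  proof (rule Weierstrass_m_test)
    show "summable euler_coeff" using euler_coeff_sums by (rule sums_summable)
    show "norm (euler_coeff n * x ^ n) \<le> euler_coeff n" if "x \<in> {0..1}" for n x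
      using that by (simp add: euler_coeff_nonneg mult_left_le power_le_one)
  qed
  then show ?thesis
    unfolding euler_series_def[abs_def]
    by (rule uniform_limit_theorem[rotated]) (auto intro!: always_eventually continuous_intros)
qed

lemma hyp2F1_three_halves_sums:
  assumes "\<bar>x\<bar> < 1"
  shows "(\<lambda>n. three_halves_coeff n * x ^ n) sums hyp2F1 (3/2) (3/2) 1 x"
proof -
  have "summable (\<lambda>n. three_halves_coeff n * x ^ n)"
  proof (cases "x = 0")
    case False
    obtain c where c: "\<bar>x\<bar> < c" "c < 1" using assms dense by blast
    have "(\<lambda>n. ((real n + 3/2) / (real n + 1))\<^sup>2 * \<bar>x\<bar>) \<longlonglongrightarrow> 1\<^sup>2 * \<bar>x\<bar>"
      by (intro tendsto_mult tendsto_power tendsto_const) real_asymp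
    then have "\<forall>\<^sub>F n in sequentially. ((real n + 3/2) / (real n + 1))\<^sup>2 * \<bar>x\<bar> < c"
      using c by (intro order_tendstoD(2)) auto
    then obtain N where N: "\<And>n. n \<ge> N \<Longrightarrow> ((real n + 3/2) / (real n + 1))\<^sup>2 * \<bar>x\<bar> < c"
      by (auto simp: eventually_sequentially)
    show ?thesis
    proof (rule summable_ratio_test[OF c(2)])
      fix n assume n: "n \<ge> N"
      have "norm (three_halves_coeff (Suc n) * x ^ Suc n)
          = ((real n + 3/2) / (real n + 1))\<^sup>2 * \<bar>x\<bar> * norm (three_halves_coeff n * x ^ n)"
        by (simp add: three_halves_coeff_Suc abs_mult power_abs)
      also have "\<dots> \<le> c * norm (three_halves_coeff n * x ^ n)"
        using N[OF n] by (intro mult_right_mono) auto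
      finally show "norm (three_halves_coeff (Suc n) * x ^ Suc n) \<le> c * norm (three_halves_coeff n * x ^ n)" .
    qed
  qed (auto intro: summable_finite[of "{0}"])
  moreover have "hyp2F1 (3/2) (3/2) 1 x = (\<Sum>n. three_halves_coeff n * x ^ n)"
    unfolding hyp2F1_def eval_fps_def
    by (intro suminf_cong)
       (simp add: three_halves_coeff_def pochhammer_fact[symmetric] power2_eq_square)
  ultimately show ?thesis by (simp add: summable_sums)
qed

lemma euler_transformation:
  assumes x: "0 \<le> x" "x < 1"
  shows "(1 - x)\<^sup>2 * hyp2F1 (3/2) (3/2) 1 x = euler_series x"
proof -
  let ?c = three_halves_coeff
  define H where "H = hyp2F1 (3/2) (3/2) 1 x"
  have s0: "(\<lambda>n. ?c n * x ^ n) sums H"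
    unfolding H_def using x by (intro hyp2F1_three_halves_sums) auto
  \<comment> \<open>The three series forming \<open>(1 - x)^2 F\<close> are aligned at the power
    \<open>x^(n+2)\<close>. The terms 1 and \<open>9/4 x\<close> split off for this leave
    \<open>1 + (9/4 - 2) x\<close>, which are the first two terms of the transformed series.\<close>
  have s1: "(\<lambda>n. ?c (Suc n) * x ^ Suc n) sums (H - 1)"
    using s0 by (subst sums_Suc_iff) (simp add: three_halves_coeff_def)
  have s2: "(\<lambda>n. ?c (Suc (Suc n)) * x ^ Suc (Suc n)) sums (H - 1 - 9/4 * x)"
    using s1 by (subst sums_Suc_iff) (simp add: three_halves_coeff_def power2_eq_square)
  have "(\<lambda>n. ?c (Suc (Suc n)) * x ^ Suc (Suc n) - 2 * x * (?c (Suc n) * x ^ Suc n) + x\<^sup>2 * (?c n * x ^ n))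
      sums (H - 1 - 9/4 * x - 2 * x * (H - 1) + x\<^sup>2 * H)"
    by (intro sums_add sums_diff sums_mult s0 s1 s2)
  also have "(\<lambda>n. ?c (Suc (Suc n)) * x ^ Suc (Suc n) - 2 * x * (?c (Suc n) * x ^ Suc n) + x\<^sup>2 * (?c n * x ^ n))
      = (\<lambda>n. euler_coeff (Suc (Suc n)) * x ^ Suc (Suc n))"
    by (simp add: euler_coeff_second_difference algebra_simps power2_eq_square)
  finally have "(\<lambda>n. euler_coeff (Suc n) * x ^ Suc n) sums
      (H - 1 - 9/4 * x - 2 * x * (H - 1) + x\<^sup>2 * H + euler_coeff 1 * x)"
    by (subst (asm) sums_Suc_iff) simp
  then have "(\<lambda>n. euler_coeff n * x ^ n) sums
      (H - 1 - 9/4 * x - 2 * x * (H - 1) + x\<^sup>2 * H + euler_coeff 1 * x + euler_coeff 0)"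
    by (subst (asm) sums_Suc_iff) simp
  then have "euler_series x = H - 1 - 9/4 * x - 2 * x * (H - 1) + x\<^sup>2 * H + euler_coeff 1 * x + euler_coeff 0"
    by (simp add: euler_series_def sums_iff)
  then show ?thesis
    by (simp add: euler_coeff_def H_def power2_eq_square algebra_simps)
qed

lemma hyp_term_eq_euler_series:
  assumes x: "0 \<le> x" "x \<le> 1"
  shows "hyp_term x = euler_series x"
proof (cases "x = 1")
  case False
  then show ?thesis using x by (simp add: hyp_term_def Let_def euler_transformation)
next
  case True
  have "(euler_series \<longlongrightarrow> euler_series 1) (at 1 within {0..1})"
    using continuous_on_euler_series by (auto simp: continuous_on_def)
  then have "(euler_series \<longlongrightarrow> euler_series 1) (at_left 1)"
    by (simp add: at_within_Icc_at_left)
  moreover have "\<forall>\<^sub>F y in at_left 1. 0 < y \<and> y < (1::real)"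
    using eventually_at_left_real[of 0 "1::real"] by (auto elim: eventually_mono)
  then have "\<forall>\<^sub>F y in at_left 1. euler_series y = (1 - y)\<^sup>2 * hyp2F1 (3/2) (3/2) 1 y"
    by eventually_elim (simp add: euler_transformation)
  ultimately have "((\<lambda>y. (1 - y)\<^sup>2 * hyp2F1 (3/2) (3/2) 1 y) \<longlongrightarrow> euler_series 1) (at_left 1)"
    by (simp add: tendsto_cong)
  then have "Lim (at_left 1) (\<lambda>y. (1 - y)\<^sup>2 * hyp2F1 (3/2) (3/2) 1 y) = euler_series 1"
    by (intro tendsto_Lim) auto
  then show ?thesis using True by (simp add: hyp_term_def Let_def)
qed

section \<open>Gaussian measures on Euclidean spaces\<close>

lemma lborel_distr_reflect:
  "distr lborel borel (\<lambda>x. t - x) = (lborel :: 'a::euclidean_space measure)"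
  using lborel_affine[of "-1" t] by (simp add: density_1)

lemma norm_preserving_bij:
  fixes T :: "'a::euclidean_space \<Rightarrow> 'a"
  assumes "linear T" "\<And>x. norm (T x) = norm x"
  shows "bij T"
proof -
  have "x = 0" if "T x = 0" for x
    using assms(2)[of x] that by simp
  then have "inj T"
    using linear_injective_0[OF assms(1)] by blast
  then show ?thesis
    using assms(1) linear_injective_imp_surjective by (auto simp: bij_def)
qed

text \<open>The image of Lebesgue measure is translation invariant, and Fubini's theorem makes a
  translation-invariant measure proportional to Lebesgue measure; the unit ball, which is mapped to
  itself, shows that the factor is 1.\<close>

lemma lborel_distr_isometry:
  fixes T :: "'a::euclidean_space \<Rightarrow> 'a"
  assumes lin: "linear T" and norm: "\<And>x. norm (T x) = norm x"
  shows "distr lborel borel T = lborel"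
proof (rule measure_eqI)
  have [measurable]: "T \<in> borel \<rightarrow>\<^sub>M borel"
    using lin by (intro borel_measurable_continuous_onI linear_continuous_on linear_conv_bounded_linear[THEN iffD1])
  fix A assume "A \<in> sets (distr lborel borel T)"
  then have A[measurable]: "A \<in> sets borel" by simp
  define B where "B = ball (0::'a) 1"
  have [measurable]: "B \<in> sets borel" by (simp add: B_def)
  have TB: "T x \<in> B \<longleftrightarrow> x \<in> B" for x by (simp add: B_def norm)
  \<comment> \<open>Integrating over y first yields the image measure of A times the measure of B.
    For the second evaluation, replacing x by x - z with \<open>T z = y\<close> moves y from B to A,
    and the y-integral is then the Lebesgue measure of A.\<close>
  let ?I = "\<integral>\<^sup>+ x. \<integral>\<^sup>+y. indicator A (T x) * indicator B (T x + y) \<partial>lborel \<partial>lborel"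
  have shift: "(\<integral>\<^sup>+y. f (z + y) \<partial>lborel) = (\<integral>\<^sup>+y. f y \<partial>lborel)"
    if [measurable]: "f \<in> borel_measurable borel" for f and z :: 'a
    by (subst (2) lborel_distr_plus[of z, symmetric]) (simp add: nn_integral_distr)
  have reflect: "(\<integral>\<^sup>+y. f (z - y) \<partial>lborel) = (\<integral>\<^sup>+y. f y \<partial>lborel)"
    if [measurable]: "f \<in> borel_measurable borel" for f and z :: 'a
    by (subst (2) lborel_distr_reflect[of z, symmetric]) (simp add: nn_integral_distr)
  have "?I = (\<integral>\<^sup>+ x. indicator A (T x) * emeasure lborel B \<partial>lborel)"
    by (intro nn_integral_cong) (simp add: nn_integral_cmult shift)
  also have "\<dots> = emeasure lborel B * emeasure (distr lborel borel T) A"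
    using nn_integral_distr[of T lborel borel "indicator A"]
    by (simp add: nn_integral_multc mult.commute[of _ "emeasure lborel B"] nn_integral_cmult)
  finally have 1: "?I = emeasure lborel B * emeasure (distr lborel borel T) A" .
  have "?I = (\<integral>\<^sup>+y. \<integral>\<^sup>+ x. indicator A (T x) * indicator B (T x + y) \<partial>lborel \<partial>lborel)"
    by (rule lborel_pair.Fubini') measurable
  also have "\<dots> = (\<integral>\<^sup>+y. \<integral>\<^sup>+ x. indicator A (T x - y) * indicator B x \<partial>lborel \<partial>lborel)"
  proof (rule nn_integral_cong)
    fix y
    obtain z where z: "T z = y"
      using norm_preserving_bij[OF lin norm] by (metis bij_pointE)
    have "(\<integral>\<^sup>+ x. indicator A (T x) * indicator B (T x + y) \<partial>lborel)
        = (\<integral>\<^sup>+ x. indicator A (T (- z + x)) * indicator B (T (- z + x) + y) \<partial>lborel)"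
      by (rule shift[symmetric]) measurable
    also have "\<dots> = (\<integral>\<^sup>+ x. indicator A (T x - y) * indicator B x \<partial>lborel)"
      by (intro nn_integral_cong)
        (auto simp: linear_diff[OF lin] linear_neg[OF lin] linear_add[OF lin] z TB indicator_def)
    finally show "(\<integral>\<^sup>+ x. indicator A (T x) * indicator B (T x + y) \<partial>lborel)
        = (\<integral>\<^sup>+ x. indicator A (T x - y) * indicator B x \<partial>lborel)" .
  qed
  also have "\<dots> = (\<integral>\<^sup>+ x. \<integral>\<^sup>+y. indicator A (T x - y) * indicator B x \<partial>lborel \<partial>lborel)"
    by (rule lborel_pair.Fubini') measurable
  also have "\<dots> = (\<integral>\<^sup>+ x. emeasure lborel A * indicator B x \<partial>lborel)"
    by (intro nn_integral_cong) (simp add: nn_integral_multc reflect)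
  also have "\<dots> = emeasure lborel B * emeasure lborel A"
    by (simp add: nn_integral_cmult_indicator mult.commute[of "emeasure lborel B"])
  finally have "emeasure lborel B * emeasure (distr lborel borel T) A = emeasure lborel B * emeasure lborel A"
    using 1 by simp
  moreover have "emeasure lborel B \<noteq> 0" "emeasure lborel B \<noteq> \<infinity>"
    using unit_ball_vol_pos[of "real DIM('a)"] by (auto simp: B_def emeasure_ball simp del: unit_ball_vol_pos)
  ultimately show "emeasure (distr lborel borel T) A = emeasure lborel A"
    by (simp add: ennreal_mult_cancel_left)
qed simp

text \<open>Each real coordinate has variance 1/2, so a complex coordinate has mean square 1. On
  \<open>complex ^ 'n\<close> the real dimension is twice \<open>CARD('n)\<close>, and the constant
  becomes \<open>pi ^ CARD('n)\<close>.\<close>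

definition std_gaussian :: "'a::euclidean_space measure" where
  "std_gaussian = density lborel (\<lambda>x. ennreal (exp (- (norm x)\<^sup>2) / sqrt pi ^ DIM('a)))"

lemma sets_std_gaussian [simp, measurable_cong]: "sets std_gaussian = sets borel"
  and space_std_gaussian [simp]: "space std_gaussian = UNIV"
  by (simp_all add: std_gaussian_def)

lemma prob_space_std_gaussian: "prob_space (std_gaussian :: 'a::euclidean_space measure)"
proof
  have "has_bochner_integral lborel (\<lambda>x::real. exp (- x\<^sup>2)) (sqrt pi)"
    using has_bochner_integral_even_function[OF gaussian_moment_0] by simp
  then have 1: "(\<integral>\<^sup>+ x. ennreal (exp (- x\<^sup>2)) \<partial> (lborel :: real measure)) = ennreal (sqrt pi)"
    by (subst nn_integral_eq_integral) (auto simp: has_bochner_integral_iff)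
  have "(\<integral>\<^sup>+ x. ennreal (exp (- (norm x)\<^sup>2)) \<partial> (lborel :: 'a measure))
      = (\<integral>\<^sup>+ x. (\<Prod>b\<in>Basis. ennreal (exp (- (inner x b)\<^sup>2))) \<partial> (lborel :: 'a measure))"
  proof (rule nn_integral_cong)
    fix x :: 'a
    have "(norm x)\<^sup>2 = (\<Sum>b\<in>Basis. (inner x b)\<^sup>2)"
      by (simp only: power2_norm_eq_inner euclidean_inner[of x x]) (simp add: power2_eq_square)
    then have "exp (- (norm x)\<^sup>2) = (\<Prod>b\<in>Basis. exp (- (inner x b)\<^sup>2))"
      by (simp only: sum_negf[symmetric] exp_sum[OF finite_Basis])
    then show "ennreal (exp (- (norm x)\<^sup>2)) = (\<Prod>b\<in>Basis. ennreal (exp (- (inner x b)\<^sup>2)))"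
      by (simp add: prod_ennreal)
  qed
  also have "\<dots> = ennreal (sqrt pi) ^ DIM('a)"
    by (subst nn_integral_lborel_prod) (simp_all add: 1)
  finally have 2: "(\<integral>\<^sup>+ x. ennreal (exp (- (norm x)\<^sup>2)) \<partial> (lborel :: 'a measure)) = ennreal (sqrt pi ^ DIM('a))"
    by (simp add: ennreal_power)
  have "emeasure (std_gaussian :: 'a measure) UNIV
      = (\<integral>\<^sup>+ x. ennreal (1 / sqrt pi ^ DIM('a)) * ennreal (exp (- (norm x)\<^sup>2)) \<partial> (lborel :: 'a measure))"
    by (simp add: std_gaussian_def emeasure_density mult.commute flip: ennreal_mult')
  also have "\<dots> = ennreal (1 / sqrt pi ^ DIM('a)) * ennreal (sqrt pi ^ DIM('a))"
    by (subst nn_integral_cmult) (simp_all add: 2)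
  also have "\<dots> = 1"
    by (simp flip: ennreal_mult')
  finally show "emeasure (std_gaussian :: 'a measure) (space std_gaussian) = 1" by simp
qed

interpretation std_gaussian: prob_space "std_gaussian :: 'a::euclidean_space measure"
  by (rule prob_space_std_gaussian)

text \<open>Squared norms add on a product, so densities multiply. Independent pairs thereby inherit
  invariance under isometries that mix the two components.\<close>

lemma std_gaussian_pair:
  "std_gaussian \<Otimes>\<^sub>M std_gaussian
     = (std_gaussian :: ('a::euclidean_space \<times> 'b::euclidean_space) measure)"
proof -
  have "std_gaussian \<Otimes>\<^sub>M std_gaussian = density (lborel \<Otimes>\<^sub>M lborel)
      (\<lambda>(x::'a, y::'b). ennreal (exp (- (norm x)\<^sup>2) / sqrt pi ^ DIM('a)) *
        ennreal (exp (- (norm y)\<^sup>2) / sqrt pi ^ DIM('b)))"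
    unfolding std_gaussian_def
    by (rule pair_measure_density)
      (auto intro: lborel.sigma_finite_measure_axioms
        std_gaussian.sigma_finite_measure_axioms[unfolded std_gaussian_def])
  also have "(\<lambda>(x::'a, y::'b). ennreal (exp (- (norm x)\<^sup>2) / sqrt pi ^ DIM('a)) *
        ennreal (exp (- (norm y)\<^sup>2) / sqrt pi ^ DIM('b)))
      = (\<lambda>z. ennreal (exp (- (norm z)\<^sup>2) / sqrt pi ^ DIM('a \<times> 'b)))"
    by (auto simp: fun_eq_iff norm_prod_def power_add exp_add[symmetric] simp flip: ennreal_mult')
  finally show ?thesis
    by (simp add: std_gaussian_def lborel_prod)
qed

lemma std_gaussian_distr_isometry:
  fixes T :: "'a::euclidean_space \<Rightarrow> 'a"
  assumes lin: "linear T" and norm: "\<And>x. norm (T x) = norm x"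
  shows "distr std_gaussian borel T = std_gaussian"
proof (rule measure_eqI)
  have [measurable]: "T \<in> borel \<rightarrow>\<^sub>M borel"
    using lin by (intro borel_measurable_continuous_onI linear_continuous_on linear_conv_bounded_linear[THEN iffD1])
  fix A assume "A \<in> sets (distr std_gaussian borel T)"
  then have A[measurable]: "A \<in> sets borel" by simp
  let ?g = "\<lambda>x::'a. ennreal (exp (- (norm x)\<^sup>2) / sqrt pi ^ DIM('a))"
  have "emeasure (distr std_gaussian borel T) A = (\<integral>\<^sup>+ x. ?g (T x) * indicator A (T x) \<partial>lborel)"
    using measurable_sets_borel[OF \<open>T \<in> borel \<rightarrow>\<^sub>M borel\<close> A]
    by (simp add: emeasure_distr std_gaussian_def emeasure_density norm indicator_vimage)
  also have "\<dots> = (\<integral>\<^sup>+ x. ?g x * indicator A x \<partial>distr lborel borel T)"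
    by (simp add: nn_integral_distr)
  also have "\<dots> = emeasure std_gaussian A"
    by (simp add: lborel_distr_isometry[OF lin norm] std_gaussian_def emeasure_density)
  finally show "emeasure (distr std_gaussian borel T) A = emeasure std_gaussian A" .
qed simp

text \<open>A substitute for polar coordinates: for functions of the modulus alone, the area
  \<open>pi r^2\<close> of discs already determines the image measure.\<close>

lemma lborel_distr_norm_complex:
  "distr lborel borel (norm :: complex \<Rightarrow> real)
     = density lborel (\<lambda>r. ennreal (2 * pi * r) * indicator {0..} r)"
proof (rule measure_eqI_generator_eq)
  let ?E = "range (\<lambda>r::real. {..r})"
  show "Int_stable ?E" by (auto simp: Int_stable_def)
  show "?E \<subseteq> Pow UNIV" by simp
  show "sets (distr lborel borel norm) = sigma_sets UNIV ?E"
    "sets (density lborel (\<lambda>r. ennreal (2 * pi * r) * indicator {0..} r)) = sigma_sets UNIV ?E"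
    by (simp_all add: borel_eq_atMost)
  have L: "emeasure (distr lborel borel (norm :: complex \<Rightarrow> real)) {..r} = ennreal (if r \<ge> 0 then pi * r\<^sup>2 else 0)" for r
  proof -
    have "emeasure (distr lborel borel (norm :: complex \<Rightarrow> real)) {..r} = emeasure lborel (cball (0::complex) r)"
      by (subst emeasure_distr) (auto simp: cball_def intro!: arg_cong2[where f=emeasure])
    then show ?thesis by (auto simp: emeasure_cball unit_ball_vol_2)
  qed
  show "emeasure (distr lborel borel (norm :: complex \<Rightarrow> real)) X
      = emeasure (density lborel (\<lambda>r. ennreal (2 * pi * r) * indicator {0..} r)) X" if "X \<in> ?E" for X
  proof -
    from that obtain r where X: "X = {..r}" by blast
    have "emeasure (density lborel (\<lambda>r. ennreal (2 * pi * r) * indicator {0..} r)) X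
        = (\<integral>\<^sup>+ x. ennreal (2 * pi * x) * indicator {0..r} x \<partial>lborel)"
      by (simp add: emeasure_density X) (auto intro!: nn_integral_cong simp: indicator_def)
    also have "\<dots> = ennreal (if r \<ge> 0 then pi * r\<^sup>2 else 0)"
    proof (cases "r \<ge> 0")
      case True
      have "(\<integral>\<^sup>+ x. ennreal (2 * pi * x) * indicator {0..r} x \<partial>lborel) = ennreal (pi * r\<^sup>2 - pi * 0\<^sup>2)"
        using True
        by (intro nn_integral_FTC_Icc) (auto intro!: derivative_eq_intros)
      then show ?thesis using True by simp
    qed auto
    finally show ?thesis by (simp add: L X)
  qed
  show "range (\<lambda>n. {..real n}) \<subseteq> ?E" by auto
  show "(\<Union>i. {..real i}) = UNIV" by (auto simp: real_arch_simple)
  show "emeasure (distr lborel borel (norm :: complex \<Rightarrow> real)) {..real i} \<noteq> \<infinity>" for i by (simp add: L)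
qed

text \<open>The factor 2 is the circumference \<open>2 pi r\<close> over the normalisation
  \<open>pi\<close>, the radius r staying in the integrand.\<close>

lemma std_gaussian_complex_radial:
  assumes "has_bochner_integral lborel (\<lambda>r. indicator {0..} r *\<^sub>R (exp (- r\<^sup>2) * r * f r)) m"
    and [measurable]: "f \<in> borel_measurable borel"
  shows "has_bochner_integral std_gaussian (\<lambda>z::complex. f (norm z) :: real) (2 * m)"
proof -
  let ?g = "\<lambda>r. exp (- r\<^sup>2) / pi * f r"
  have "has_bochner_integral lborel (\<lambda>r. 2 * (indicator {0..} r *\<^sub>R (exp (- r\<^sup>2) * r * f r))) (2 * m)"
    by (intro has_bochner_integral_mult_right assms)
  also have "(\<lambda>r. 2 * (indicator {0..} r *\<^sub>R (exp (- r\<^sup>2) * r * f r)))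
      = (\<lambda>r. (2 * pi * r * indicator {0..} r) *\<^sub>R ?g r)"
    by (auto simp: fun_eq_iff)
  finally have "has_bochner_integral (density lborel (\<lambda>r. ennreal (2 * pi * r * indicator {0..} r))) ?g (2 * m)"
    by (intro has_bochner_integral_density) (auto simp: indicator_def)
  also have "density lborel (\<lambda>r. ennreal (2 * pi * r * indicator {0..} r))
      = distr lborel borel (norm :: complex \<Rightarrow> real)"
    unfolding lborel_distr_norm_complex by (intro density_cong) (auto simp: indicator_def)
  finally have "has_bochner_integral lborel (\<lambda>z::complex. ?g (norm z)) (2 * m)"
    by (simp add: has_bochner_integral_iff integrable_distr_eq integral_distr)
  then have "has_bochner_integral lborel (\<lambda>z::complex. (exp (- (norm z)\<^sup>2) / sqrt pi ^ DIM(complex)) *\<^sub>R f (norm z)) (2 * m)"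
    by (simp add: DIM_complex)
  then show ?thesis
    unfolding std_gaussian_def by (intro has_bochner_integral_density) auto
qed

lemma std_gaussian_complex_norm:
  "has_bochner_integral std_gaussian (\<lambda>z::complex. norm z) (sqrt pi / 2)"
proof -
  have "has_bochner_integral lborel (\<lambda>r::real. indicator {0..} r *\<^sub>R (exp (- r\<^sup>2) * r * r)) (sqrt pi / 4)"
    using gaussian_moment_even_pos[of 1] by (simp add: power2_eq_square mult.assoc)
  from std_gaussian_complex_radial[OF this] show ?thesis by simp
qed

lemma std_gaussian_complex_norm_sq:
  "has_bochner_integral std_gaussian (\<lambda>z::complex. (norm z)\<^sup>2) 1"
proof -
  have "has_bochner_integral lborel (\<lambda>r::real. indicator {0..} r *\<^sub>R (exp (- r\<^sup>2) * r * r\<^sup>2)) (1 / 2)"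
    using gaussian_moment_odd_pos[of 1] by (simp add: power2_eq_square power3_eq_cube mult.assoc)
  from std_gaussian_complex_radial[OF this] show ?thesis by simp
qed

section \<open>The moduli of two Gaussian projections\<close>

lemma herm_prod_add_right: "herm_prod x (y + z) = herm_prod x y + herm_prod x z"
  and herm_prod_add_left: "herm_prod (x + y) z = herm_prod x z + herm_prod y z"
  and herm_prod_diff_left: "herm_prod (x - y) z = herm_prod x z - herm_prod y z"
  and herm_prod_scale_right: "herm_prod x (c *s y) = c * herm_prod x y"
  and herm_prod_scale_left: "herm_prod (c *s x) y = cnj c * herm_prod x y"
  and herm_prod_scaleR_right: "herm_prod x (r *\<^sub>R y) = of_real r * herm_prod x y"
  and herm_prod_scaleR_left: "herm_prod (r *\<^sub>R x) y = of_real r * herm_prod x y"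
  and herm_prod_zero_left [simp]: "herm_prod 0 x = 0"
  and herm_prod_zero_right [simp]: "herm_prod x 0 = 0"
  by (simp_all add: herm_prod_def algebra_simps sum.distrib sum_subtractf sum_distrib_left
      scaleR_conv_of_real[where 'a=complex])

lemma cnj_herm_prod: "cnj (herm_prod x y) = herm_prod y x"
  by (simp add: herm_prod_def mult.commute)

lemma inner_eq_Re_herm_prod: "inner x y = Re (herm_prod x y)"
  by (simp add: herm_prod_def inner_vec_def inner_complex_def)

lemma herm_prod_self: "herm_prod x x = of_real ((norm x)\<^sup>2)"
proof (rule complex_eqI)
  show "Re (herm_prod x x) = Re (of_real ((norm x)\<^sup>2))"
    by (simp add: power2_norm_eq_inner inner_eq_Re_herm_prod)
  show "Im (herm_prod x x) = Im (of_real ((norm x)\<^sup>2))"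
    by (simp add: herm_prod_def)
qed

lemma norm_sq_eq_Re_herm_prod: "(norm x)\<^sup>2 = Re (herm_prod x x)"
  by (simp add: herm_prod_self)

lemma norm_smult_complex_vec: "norm (c *s x) = cmod c * norm (x :: complex ^ 'n)"
proof -
  have "complex_of_real ((norm (c *s x))\<^sup>2) = complex_of_real ((cmod c * norm x)\<^sup>2)"
    by (simp add: herm_prod_self[symmetric] herm_prod_scale_left herm_prod_scale_right
        complex_norm_square[of c] power_mult_distrib del: of_real_power)
  then show ?thesis by (simp only: of_real_eq_iff) simp
qed

lemma smult_complex_of_real: "complex_of_real r *s x = r *\<^sub>R x"
  by (simp add: vec_eq_iff scaleR_conv_of_real[where 'a=complex])

lemma linear_herm_prod: "linear (herm_prod a)"
  by (rule linearI)
    (simp_all add: herm_prod_add_right herm_prod_scaleR_right scaleR_conv_of_real[where 'a=complex])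

lemma borel_measurable_herm_prod [measurable]: "herm_prod a \<in> borel_measurable borel"
  by (intro borel_measurable_continuous_onI linear_continuous_on)
    (simp add: linear_conv_bounded_linear[symmetric] linear_herm_prod)

text \<open>For a unit vector \<open>a\<close> this isometry of \<open>\<complex> \<times> \<complex>\<^sup>n\<close> exchanges the scalar with the \<open>a\<close>-component
  of the vector.\<close>

definition exchange :: "complex ^ 'n \<Rightarrow> complex \<times> (complex ^ 'n) \<Rightarrow> complex \<times> (complex ^ 'n)" where
  "exchange a = (\<lambda>(z, u). (herm_prod a u, u + (z - herm_prod a u) *s a))"

lemma std_gaussian_distr_snd:
  "distr (std_gaussian \<Otimes>\<^sub>M std_gaussian :: ('a::euclidean_space \<times> 'b::euclidean_space) measure) std_gaussian snd
     = std_gaussian"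
proof -
  interpret pair_sigma_finite "std_gaussian :: 'a measure" "std_gaussian :: 'b measure"
    by unfold_locales
  have "distr (std_gaussian \<Otimes>\<^sub>M std_gaussian :: ('a \<times> 'b) measure) std_gaussian snd
      = distr (std_gaussian \<Otimes>\<^sub>M std_gaussian :: ('b \<times> 'a) measure) std_gaussian fst"
    by (subst distr_pair_swap, subst distr_distr) (auto simp: comp_def split_beta' intro!: distr_cong)
  then show ?thesis by (simp add: std_gaussian.distr_pair_fst)
qed

lemma linear_exchange: "linear (exchange a)"
  by (rule linearI)
    (auto simp: exchange_def herm_prod_add_right herm_prod_scaleR_right vec_eq_iff algebra_simps
      scaleR_conv_of_real[where 'a=complex])

lemma norm_exchange:
  assumes "norm a = 1"
  shows "norm (exchange a p) = norm p"
proof -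
  obtain z u where p: "p = (z, u)" by (cases p)
  let ?w = "herm_prod a u"
  have aa: "herm_prod a a = 1" by (simp add: herm_prod_self assms)
  have "of_real ((norm (u + (z - ?w) *s a))\<^sup>2)
      = of_real ((norm u)\<^sup>2) + (z * cnj z - ?w * cnj ?w)"
    unfolding herm_prod_self[symmetric] herm_prod_add_left herm_prod_add_right herm_prod_scale_left
      herm_prod_scale_right aa cnj_herm_prod[of a u, symmetric]
    by (simp add: algebra_simps)
  then have "(norm (u + (z - ?w) *s a))\<^sup>2 = (norm u)\<^sup>2 + (cmod z)\<^sup>2 - (cmod ?w)\<^sup>2"
    unfolding complex_norm_square[symmetric] of_real_diff[symmetric] of_real_add[symmetric] of_real_eq_iff by simp
  then show ?thesis
    by (simp add: p exchange_def norm_prod_def)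
qed

lemma std_gaussian_exchange:
  assumes "norm a = 1"
  shows "distr (std_gaussian \<Otimes>\<^sub>M std_gaussian) (std_gaussian \<Otimes>\<^sub>M std_gaussian) (exchange a)
      = std_gaussian \<Otimes>\<^sub>M std_gaussian"
  using std_gaussian_distr_isometry[OF linear_exchange norm_exchange[OF assms]]
  unfolding std_gaussian_pair by (simp cong: distr_cong)

lemma borel_measurable_exchange [measurable]: "exchange a \<in> borel \<rightarrow>\<^sub>M borel"
  by (intro borel_measurable_continuous_onI linear_continuous_on)
    (simp add: linear_conv_bounded_linear[symmetric] linear_exchange)

text \<open>The projection is the first component of the exchanged pair, whose joint law is that of
  the original pair; hence it is distributed like the scalar z.\<close>

lemma std_gaussian_distr_herm_prod:
  assumes "norm (a :: complex ^ 'n) = 1"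
  shows "distr std_gaussian borel (herm_prod a) = std_gaussian"
proof -
  let ?M = "std_gaussian \<Otimes>\<^sub>M (std_gaussian :: (complex ^ 'n) measure) :: (complex \<times> _) measure"
  have [measurable]: "exchange a \<in> ?M \<rightarrow>\<^sub>M ?M"
    unfolding std_gaussian_pair measurable_cong_sets[OF sets_std_gaussian sets_std_gaussian]
    by (rule borel_measurable_exchange)
  have "std_gaussian = distr ?M std_gaussian fst"
    by (rule std_gaussian.distr_pair_fst[symmetric])
  also have "\<dots> = distr (distr ?M ?M (exchange a)) std_gaussian fst"
    by (simp only: std_gaussian_exchange[OF assms])
  also have "\<dots> = distr ?M std_gaussian (\<lambda>x. herm_prod a (snd x))"
  proof -
    have "fst \<circ> exchange a = (\<lambda>x. herm_prod a (snd x))"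
      by (auto simp: exchange_def)
    then show ?thesis by (subst distr_distr) auto
  qed
  also have "\<dots> = distr (distr ?M std_gaussian snd) std_gaussian (herm_prod a)"
    by (subst distr_distr) (auto simp: comp_def)
  also have "distr ?M std_gaussian snd = std_gaussian"
    by (rule std_gaussian_distr_snd)
  finally show ?thesis by (simp cong: distr_cong)
qed

text \<open>The \<open>a\<close>-component of u may be replaced by an independent scalar z without
  changing the law. With the projection isolated as a separate variable, conditioning on it becomes
  Fubini's theorem.\<close>

lemma std_gaussian_decompose:
  assumes "norm (a :: complex ^ 'n) = 1"
  shows "distr (std_gaussian \<Otimes>\<^sub>M std_gaussian) std_gaussian (\<lambda>p. snd (exchange a p)) = std_gaussian"
proof -
  let ?M = "std_gaussian \<Otimes>\<^sub>M (std_gaussian :: (complex ^ 'n) measure) :: (complex \<times> _) measure"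
  have [measurable]: "exchange a \<in> ?M \<rightarrow>\<^sub>M ?M"
    unfolding std_gaussian_pair measurable_cong_sets[OF sets_std_gaussian sets_std_gaussian]
    by (rule borel_measurable_exchange)
  have "std_gaussian = distr (distr ?M ?M (exchange a)) std_gaussian snd"
    by (simp only: std_gaussian_exchange[OF assms] std_gaussian_distr_snd)
  also have "\<dots> = distr ?M std_gaussian (\<lambda>p. snd (exchange a p))"
    by (subst distr_distr) (auto simp: comp_def)
  finally show ?thesis ..
qed

lemma std_gaussian_herm_prod_unit:
  fixes f :: "complex \<Rightarrow> real"
  assumes "norm (a :: complex ^ 'n) = 1" "has_bochner_integral std_gaussian f m"
  shows "has_bochner_integral std_gaussian (\<lambda>u. f (herm_prod a u)) m"
proof -
  have [measurable]: "f \<in> borel_measurable borel"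
    using borel_measurable_has_bochner_integral[OF assms(2)] by simp
  have "has_bochner_integral (distr std_gaussian borel (herm_prod a)) f m"
    using assms(2) std_gaussian_distr_herm_prod[OF assms(1)] by simp
  then show ?thesis
    by (simp add: has_bochner_integral_iff integrable_distr_eq integral_distr)
qed

lemma std_gaussian_cmod_herm_prod:
  fixes a :: "complex ^ 'n"
  shows "has_bochner_integral std_gaussian (\<lambda>u. cmod (herm_prod a u)) (norm a * sqrt pi / 2)"
    and "has_bochner_integral std_gaussian (\<lambda>u. (cmod (herm_prod a u))\<^sup>2) ((norm a)\<^sup>2)"
proof -
  have *: "has_bochner_integral std_gaussian (\<lambda>u. cmod (herm_prod a u)) (norm a * sqrt pi / 2) \<and>
     has_bochner_integral std_gaussian (\<lambda>u. (cmod (herm_prod a u))\<^sup>2) ((norm a)\<^sup>2)"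
  proof (cases "a = 0")
    case False
    define b where "b = (1 / norm a) *\<^sub>R a"
    have b: "norm b = 1" using False by (simp add: b_def)
    have a: "cmod (herm_prod a u) = norm a * cmod (herm_prod b u)" for u
      using False by (simp add: b_def herm_prod_scaleR_left norm_mult norm_divide)
    show ?thesis
      unfolding a power_mult_distrib
      using has_bochner_integral_mult_right[OF std_gaussian_herm_prod_unit[OF b std_gaussian_complex_norm], of "norm a"]
        has_bochner_integral_mult_right[OF std_gaussian_herm_prod_unit[OF b std_gaussian_complex_norm_sq], of "(norm a)\<^sup>2"]
      by (simp add: False)
  qed (auto simp: has_bochner_integral_zero)
  from * show "has_bochner_integral std_gaussian (\<lambda>u. cmod (herm_prod a u)) (norm a * sqrt pi / 2)" ..
  from * show "has_bochner_integral std_gaussian (\<lambda>u. (cmod (herm_prod a u))\<^sup>2) ((norm a)\<^sup>2)" ..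
qed

text \<open>Makes negligible the event on which \<open>phase_opt\<close> takes its default value
  0.\<close>

lemma AE_std_gaussian_herm_prod_nonzero:
  fixes a :: "complex ^ 'n"
  assumes "a \<noteq> 0"
  shows "AE u in std_gaussian. herm_prod a u \<noteq> 0"
proof -
  define b where "b = (1 / norm a) *\<^sub>R a"
  have b: "norm b = 1" using assms by (simp add: b_def)
  have "AE z in lborel. z \<noteq> (0 :: complex)" by (rule AE_lborel_singleton)
  then have "AE z in std_gaussian. z \<noteq> (0 :: complex)"
    unfolding std_gaussian_def by (subst AE_density) auto
  then have "AE z in distr std_gaussian borel (herm_prod b). z \<noteq> 0"
    unfolding std_gaussian_distr_herm_prod[OF b] .
  then have "AE u in std_gaussian. herm_prod b u \<noteq> 0"
    by (subst (asm) AE_distr_iff) auto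
  then show ?thesis
    using assms by (simp add: b_def herm_prod_scaleR_left)
qed

text \<open>The integral is an even convex function of \<open>z\<close> that depends on \<open>z\<close> only through \<open>|z|\<close>, because
  the Gaussian law is invariant under multiplication by a phase.\<close>

lemma std_gaussian_shifted_modulus_mono:
  fixes b :: "complex ^ 'n" and k z z' :: complex
  defines "G \<equiv> \<lambda>z. \<integral>u. cmod (k * z + herm_prod b u) \<partial>std_gaussian"
  assumes "cmod z \<le> cmod z'"
  shows "G z \<le> G z'"
proof (cases "z' = 0")
  case False
  have int: "integrable std_gaussian (\<lambda>u. cmod (c + herm_prod b u))" for c
  proof (rule Bochner_Integration.integrable_bound)
    show "integrable std_gaussian (\<lambda>u. cmod c + cmod (herm_prod b u))"
      using std_gaussian_cmod_herm_prod(1)[of b] by (auto simp: has_bochner_integral_iff)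
    show "AE u in std_gaussian. norm (cmod (c + herm_prod b u)) \<le> norm (cmod c + cmod (herm_prod b u))"
      by (auto intro: norm_triangle_ineq)
  qed measurable
  have phase: "G (c * z) = G z" if c: "cmod c = 1" for c z
  proof -
    let ?T = "\<lambda>u :: complex ^ 'n. c *s u"
    have lin: "linear ?T"
      by (rule linearI) (auto simp: vec_eq_iff algebra_simps scaleR_conv_of_real[where 'a=complex])
    have nrm: "norm (?T u) = norm u" for u
      by (simp add: norm_smult_complex_vec c)
    have [measurable]: "?T \<in> borel_measurable borel"
      using lin by (intro borel_measurable_continuous_onI linear_continuous_on linear_conv_bounded_linear[THEN iffD1])
    have "G (c * z) = (\<integral>u. cmod (k * (c * z) + herm_prod b u) \<partial>distr std_gaussian borel ?T)"
      by (simp add: G_def std_gaussian_distr_isometry[OF lin nrm])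
    also have "\<dots> = (\<integral>u. cmod (c * (k * z + herm_prod b u)) \<partial>std_gaussian)"
      by (subst integral_distr) (auto simp: herm_prod_scale_right algebra_simps)
    finally show ?thesis by (simp add: G_def norm_mult c)
  qed
  define t where "t = cmod z / cmod z'"
  have t: "0 \<le> t" "t \<le> 1" using assms False by (auto simp: t_def)
  have "G z = G (of_real t * z')"
  proof (cases "z = 0")
    case True
    then show ?thesis by (simp add: t_def)
  next
    case nz: False
    have "z = (sgn z / sgn z') * (of_real t * z')"
      using False nz by (simp add: t_def sgn_eq field_simps)
    moreover have "cmod (sgn z / sgn z') = 1"
      using False nz by (simp add: norm_divide norm_sgn)
    ultimately show ?thesis using phase by metis
  qed
  \<comment> \<open>The point \<open>t z'\<close> is the convex combination of z' and -z' with
    weights \<open>(1 + t)/2\<close> and \<open>(1 - t)/2\<close>; \<open>G\<close> has the same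
    value at both ends.\<close>
  also have "\<dots> \<le> (\<integral>u. (1 + t) / 2 * cmod (k * z' + herm_prod b u) + (1 - t) / 2 * cmod (k * (- 1 * z') + herm_prod b u) \<partial>std_gaussian)"
    unfolding G_def
  proof (intro integral_mono int Bochner_Integration.integrable_add integrable_mult_right)
    fix u
    let ?w = "herm_prod b u"
    have "k * (of_real t * z') + ?w = of_real ((1 + t) / 2) * (k * z' + ?w) + of_real ((1 - t) / 2) * (k * (- 1 * z') + ?w)"
      by (simp add: field_simps)
    then have "cmod (k * (of_real t * z') + ?w)
        \<le> cmod (of_real ((1 + t) / 2) * (k * z' + ?w)) + cmod (of_real ((1 - t) / 2) * (k * (- 1 * z') + ?w))"
      by (metis norm_triangle_ineq)
    also have "\<dots> = (1 + t) / 2 * cmod (k * z' + ?w) + (1 - t) / 2 * cmod (k * (- 1 * z') + ?w)"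
      using t by (simp only: norm_mult norm_of_real) simp
    finally show "cmod (k * (of_real t * z') + ?w)
        \<le> (1 + t) / 2 * cmod (k * z' + ?w) + (1 - t) / 2 * cmod (k * (- 1 * z') + ?w)" .
  qed
  also have "\<dots> = (1 + t) / 2 * G z' + (1 - t) / 2 * G (- 1 * z')"
    unfolding G_def
    by (simp only: Bochner_Integration.integral_add[OF integrable_mult_right[OF int] integrable_mult_right[OF int]]
        integral_mult_right_zero)
  also have "\<dots> = G z'"
    by (subst phase) (auto simp: field_simps)
  finally show ?thesis .
qed (use assms in simp)

text \<open>Write \<open>u\<close> as an independent sum of \<open>z a\<close> and a remainder. The conditional mean of \<open>|b\<^sup>H u|\<close> given
  \<open>z\<close> increases with \<open>|z| = |a\<^sup>H u|\<close>, so the two moduli are nonnegatively correlated.\<close>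

lemma std_gaussian_moduli_correlation:
  fixes a b :: "complex ^ 'n"
  assumes a: "norm a = 1" and b: "norm b = 1"
  shows "integrable std_gaussian (\<lambda>u. cmod (herm_prod a u) * cmod (herm_prod b u))" (is "integrable _ ?f")
    and "pi / 4 \<le> (\<integral>u. cmod (herm_prod a u) * cmod (herm_prod b u) \<partial>std_gaussian)"
    and "(\<integral>u. cmod (herm_prod a u) * cmod (herm_prod b u) \<partial>std_gaussian) \<le> 1"
proof -
  let ?g = "\<lambda>u. ((cmod (herm_prod a u))\<^sup>2 + (cmod (herm_prod b u))\<^sup>2) / 2"
  have g: "has_bochner_integral std_gaussian ?g 1"
    using has_bochner_integral_divide_zero[OF has_bochner_integral_add[OF
        std_gaussian_cmod_herm_prod(2)[of a] std_gaussian_cmod_herm_prod(2)[of b]], of 2]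
    by (simp add: a b)
  have fg: "?f u \<le> ?g u" for u
    using sum_squares_bound[of "cmod (herm_prod a u)" "cmod (herm_prod b u)"] by simp
  show int: "integrable std_gaussian ?f"
  proof (rule Bochner_Integration.integrable_bound)
    show "integrable std_gaussian ?g" using g by (simp add: has_bochner_integral_iff)
    show "AE u in std_gaussian. norm (?f u) \<le> norm (?g u)" using fg by (auto simp: order_trans)
  qed measurable
  show "(\<integral>u. ?f u \<partial>std_gaussian) \<le> 1"
    using integral_mono[OF int _ fg] g by (simp add: has_bochner_integral_iff)

  let ?M = "std_gaussian \<Otimes>\<^sub>M (std_gaussian :: (complex ^ 'n) measure) :: (complex \<times> _) measure"
  interpret pr: pair_sigma_finite "std_gaussian :: complex measure" "std_gaussian :: (complex ^ 'n) measure"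
    by unfold_locales
  have [measurable]: "exchange a \<in> ?M \<rightarrow>\<^sub>M ?M"
    unfolding std_gaussian_pair measurable_cong_sets[OF sets_std_gaussian sets_std_gaussian]
    by (rule borel_measurable_exchange)
  \<comment> \<open>\<open>b'\<close> is the part of b orthogonal to a, so \<open>k * z\<close>
    carries the whole dependence of the second projection on the first.\<close>
  define k where "k = herm_prod b a"
  define b' where "b' = b - cnj k *s a"
  define G where "G z = (\<integral>u. cmod (k * z + herm_prod b' u) \<partial>std_gaussian)" for z
  have aa: "herm_prod a a = 1" by (simp add: herm_prod_self a)
  have ea: "herm_prod a (snd (exchange a (z, u))) = z" for z u
    by (simp add: exchange_def herm_prod_add_right herm_prod_scale_right aa del: vector_sub_rdistrib)
  have eb: "herm_prod b (snd (exchange a (z, u))) = k * z + herm_prod b' u" for z u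
    unfolding exchange_def b'_def k_def
    by (simp add: herm_prod_add_right herm_prod_scale_right herm_prod_diff_left
        herm_prod_scale_left del: vector_sub_rdistrib) (simp add: algebra_simps)
  have via_pair: "integrable std_gaussian (\<lambda>z. \<integral>u. h (snd (exchange a (z, u))) \<partial>std_gaussian)"
    "(\<integral>z. \<integral>u. h (snd (exchange a (z, u))) \<partial>std_gaussian \<partial>std_gaussian) = (\<integral>u. h u \<partial>std_gaussian)"
    if h: "integrable std_gaussian h" for h :: "complex ^ 'n \<Rightarrow> real"
  proof -
    have [measurable]: "h \<in> borel_measurable borel"
      using borel_measurable_integrable[OF h] by simp
    have *: "integrable ?M (\<lambda>p. h (snd (exchange a p)))"
      using h by (subst (asm) std_gaussian_decompose[OF a, symmetric]) (simp add: integrable_distr_eq)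
    show "integrable std_gaussian (\<lambda>z. \<integral>u. h (snd (exchange a (z, u))) \<partial>std_gaussian)"
      using pr.integrable_fst'[OF *] .
    have "(\<integral>u. h u \<partial>std_gaussian) = (\<integral>p. h (snd (exchange a p)) \<partial>?M)"
      by (subst std_gaussian_decompose[OF a, symmetric]) (simp add: integral_distr)
    then show "(\<integral>z. \<integral>u. h (snd (exchange a (z, u))) \<partial>std_gaussian \<partial>std_gaussian) = (\<integral>u. h u \<partial>std_gaussian)"
      using pr.integral_fst'[OF *] by simp
  qed
  have F: "integrable std_gaussian (\<lambda>z. cmod z * G z)" "(\<integral>z. cmod z * G z \<partial>std_gaussian) = (\<integral>u. ?f u \<partial>std_gaussian)"
    using via_pair[OF int] by (simp_all add: ea eb G_def)
  have B: "has_bochner_integral std_gaussian (\<lambda>u. cmod (herm_prod b u)) (sqrt pi / 2)"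
    using std_gaussian_cmod_herm_prod(1)[of b] by (simp add: b)
  have G: "integrable std_gaussian G" "(\<integral>z. G z \<partial>std_gaussian) = sqrt pi / 2"
    using B via_pair[of "\<lambda>u. cmod (herm_prod b u)"]
    by (simp_all add: eb G_def[symmetric] has_bochner_integral_iff)
  have Z: "integrable std_gaussian cmod" "(\<integral>z. cmod z \<partial>std_gaussian) = sqrt pi / 2"
    using std_gaussian_complex_norm by (auto simp: has_bochner_integral_iff)
  \<comment> \<open>Chebyshev's association argument: \<open>G\<close> increases with the modulus,
    so \<open>cmod z - m\<close> and \<open>G z - G z0\<close> never have opposite signs when z0 has
    modulus m. Taking m as the mean of the modulus makes the terms with \<open>G z0\<close>
    cancel.\<close>
  define m where "m = sqrt pi / 2"
  define z0 where "z0 = complex_of_real m"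
  have z0: "cmod z0 = m" by (simp add: z0_def m_def)
  have "0 \<le> (\<integral>z. (cmod z - m) * (G z - G z0) \<partial>std_gaussian)"
  proof (rule integral_nonneg_AE, rule AE_I2)
    fix z
    show "0 \<le> (cmod z - m) * (G z - G z0)"
      using std_gaussian_shifted_modulus_mono[of z z0 k b'] std_gaussian_shifted_modulus_mono[of z0 z k b']
      unfolding G_def[symmetric] z0
      by (cases "cmod z \<le> m") (auto intro: mult_nonneg_nonneg mult_nonpos_nonpos)
  qed
  also have "(\<lambda>z. (cmod z - m) * (G z - G z0)) = (\<lambda>z. cmod z * G z - m * G z - G z0 * cmod z + m * G z0)"
    by (auto simp: algebra_simps)
  also have "(\<integral>z. cmod z * G z - m * G z - G z0 * cmod z + m * G z0 \<partial>std_gaussian)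
      = (\<integral>u. ?f u \<partial>std_gaussian) - m * m - G z0 * m + m * G z0"
    using F G[folded m_def] Z[folded m_def] std_gaussian.prob_space[where 'a = complex]
    by simp
  finally have "m * m \<le> (\<integral>u. ?f u \<partial>std_gaussian)" by simp
  then show "pi / 4 \<le> (\<integral>u. ?f u \<partial>std_gaussian)"
    by (simp add: m_def)
qed

section \<open>Self-adjoint operators and square roots\<close>

text \<open>Working over a real inner product serves two purposes: complex matrices acting on the
  underlying real space, and real kernels that are to be written as Gram matrices.\<close>

definition self_adjoint :: "('a::euclidean_space \<Rightarrow> 'a) \<Rightarrow> bool" where
  "self_adjoint f \<longleftrightarrow> linear f \<and> (\<forall>x y. inner (f x) y = inner x (f y))"

definition psd_operator :: "('a::euclidean_space \<Rightarrow> 'a) \<Rightarrow> bool" where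
  "psd_operator f \<longleftrightarrow> self_adjoint f \<and> (\<forall>x. 0 \<le> inner x (f x))"

text \<open>A maximiser of the Rayleigh quotient on an invariant subspace is an eigenvector.\<close>

lemma self_adjoint_eigenvector:
  fixes f :: "'a::euclidean_space \<Rightarrow> 'a"
  assumes f: "self_adjoint f" and S: "subspace S" "\<And>x. x \<in> S \<Longrightarrow> f x \<in> S" and nontriv: "S \<noteq> {0}"
  shows "\<exists>v l. v \<in> S \<and> norm v = 1 \<and> f v = l *\<^sub>R v"
proof -
  have lin: "linear f" and adj: "\<And>x y. inner (f x) y = inner x (f y)"
    using f by (auto simp: self_adjoint_def)
  let ?K = "S \<inter> sphere 0 1"
  obtain w where w: "w \<in> S" "w \<noteq> 0" using nontriv subspace_0[OF S(1)] by blast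
  have "compact ?K"
    using closed_subspace[OF S(1)] by (simp add: closed_Int_compact)
  moreover have "(1 / norm w) *\<^sub>R w \<in> ?K"
    using w subspace_scale[OF S(1)] by simp
  moreover have "continuous_on ?K (\<lambda>x. inner x (f x))"
    using lin by (intro continuous_intros linear_continuous_on linear_conv_bounded_linear[THEN iffD1])
  ultimately obtain v where v: "v \<in> ?K" and max: "\<And>x. x \<in> ?K \<Longrightarrow> inner x (f x) \<le> inner v (f v)"
    using continuous_attains_sup[of ?K "\<lambda>x. inner x (f x)"] by blast
  define l where "l = inner v (f v)"
  have vv: "inner v v = 1" using v by (simp add: dot_square_norm)
  have bound: "inner x (f x) \<le> l * inner x x" if x: "x \<in> S" for x
  proof (cases "x = 0")
    case False
    have "(1 / norm x) *\<^sub>R x \<in> ?K"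
      using x False subspace_scale[OF S(1)] by simp
    from max[OF this] have "inner x (f x) / (norm x)\<^sup>2 \<le> l"
      by (simp add: linear_cmul[OF lin] l_def power2_eq_square)
    then show ?thesis using False by (simp add: divide_simps dot_square_norm mult.commute)
  qed (simp add: linear_0[OF lin])
  define y where "y = f v - l *\<^sub>R v"
  have yS: "y \<in> S"
    using v S by (auto simp: y_def intro!: subspace_diff subspace_scale)
  have yv: "inner y v = 0" by (simp add: y_def inner_diff_left vv l_def inner_commute[of "f v"])
  have yf: "inner y (f v) = inner y y"
    using yv by (simp add: y_def inner_diff_right)
  \<comment> \<open>The Rayleigh bound at the perturbed vector \<open>v + t y\<close>: the gain is
    of first order in t, the allowance only of second order, so a small t excludes y from being
    nonzero.\<close>
  have quad: "2 * t * inner y y \<le> t\<^sup>2 * (l * inner y y - inner y (f y))" for t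
  proof -
    have "inner (v + t *\<^sub>R y) (f (v + t *\<^sub>R y)) \<le> l * inner (v + t *\<^sub>R y) (v + t *\<^sub>R y)"
      using v yS S(1) by (intro bound) (auto intro: subspace_add subspace_scale)
    moreover have "inner v (f y) = inner y y" using adj[of v y] yf by (simp add: inner_commute)
    ultimately show ?thesis
      using yv yf
      by (simp add: linear_add[OF lin] linear_cmul[OF lin] inner_add_left inner_add_right vv l_def[symmetric]
          inner_commute[of v y] algebra_simps power2_eq_square)
  qed
  define C where "C = l * inner y y - inner y (f y)"
  have "inner y y = 0"
  proof (rule ccontr)
    assume "inner y y \<noteq> 0"
    then have pos: "0 < inner y y" by simp
    \<comment> \<open>Chosen so that t times the modulus of C stays strictly below
      \<open>inner y y\<close>; adding 1 keeps the denominator positive.\<close>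
    define t where "t = inner y y / (\<bar>C\<bar> + 1)"
    have t: "0 < t" using pos by (simp add: t_def)
    have "t * C \<le> t * \<bar>C\<bar>" using t by simp
    also have "\<dots> < inner y y * 1"
      using pos by (simp add: t_def divide_simps)
    finally have "t * C < 2 * inner y y" using pos by linarith
    then have "t * (t * C) < t * (2 * inner y y)" using t by simp
    then show False using quad[of t] by (simp add: C_def power2_eq_square algebra_simps)
  qed
  then have "f v = l *\<^sub>R v" by (simp add: y_def)
  then show ?thesis using v by auto
qed

text \<open>Self-adjointness makes the orthogonal complement of an eigenvector invariant again, so
  the dimension of the invariant subspace can be reduced. Stating the claim for subspaces makes this
  induction possible.\<close>

lemma self_adjoint_eigenbasis_subspace:
  fixes f :: "'a::euclidean_space \<Rightarrow> 'a"
  assumes f: "self_adjoint f" and S: "subspace S" "\<And>x. x \<in> S \<Longrightarrow> f x \<in> S"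
  shows "\<exists>B l. finite B \<and> pairwise orthogonal B \<and> (\<forall>b\<in>B. norm b = 1 \<and> f b = l b *\<^sub>R b) \<and> span B = S"
  using S
proof (induction "dim S" arbitrary: S rule: less_induct)
  case less
  have lin: "linear f" and adj: "\<And>x y. inner (f x) y = inner x (f y)"
    using f by (auto simp: self_adjoint_def)
  show ?case
  proof (cases "S = {0}")
    case True
    then show ?thesis by (intro exI[of _ "{}"]) auto
  next
    case False
    obtain v c where v: "v \<in> S" "norm v = 1" "f v = c *\<^sub>R v"
      using self_adjoint_eigenvector[OF f less.prems False] by blast
    have vv: "inner v v = 1" using v by (simp add: dot_square_norm)
    define S' where "S' = {x \<in> S. inner v x = 0}"
    have S': "subspace S'"
      using less.prems(1) by (auto simp: S'_def subspace_def inner_add_right)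
    have inv: "f x \<in> S'" if "x \<in> S'" for x
      using that less.prems(2) by (auto simp: S'_def adj[symmetric] v(3))
    have "v \<notin> S'" by (simp add: S'_def vv)
    moreover have "S' \<subseteq> S" by (auto simp: S'_def)
    ultimately have "S' \<subset> S" using v by blast
    then have "dim S' < dim S"
      using S' less.prems(1) by (intro dim_psubset) (simp_all add: span_eq_iff[THEN iffD2])
    from less.hyps[OF this S' inv] obtain B l where
      B: "finite B" "pairwise orthogonal B" "\<And>b. b \<in> B \<Longrightarrow> norm b = 1 \<and> f b = l b *\<^sub>R b" "span B = S'"
      by blast
    have BS: "b \<in> S'" if "b \<in> B" for b using that B(4) span_base by blast
    have vB: "v \<notin> B" using BS vv by (auto simp: S'_def)
    have "span (insert v B) = S"
    proof
      have "insert v B \<subseteq> S" using BS v by (auto simp: S'_def)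
      then show "span (insert v B) \<subseteq> S" using less.prems(1) by (rule span_minimal)
      show "S \<subseteq> span (insert v B)"
      proof
        fix x assume x: "x \<in> S"
        have "x - inner v x *\<^sub>R v \<in> S'"
          using x v less.prems(1) by (auto simp: S'_def inner_diff_right vv intro: subspace_diff subspace_scale)
        then show "x \<in> span (insert v B)" using B(4) by (auto simp: span_insert)
      qed
    qed
    moreover have "pairwise orthogonal (insert v B)"
      using B(2) BS by (auto simp: pairwise_insert orthogonal_def S'_def inner_commute)
    ultimately show ?thesis
      using B v vB by (intro exI[of _ "insert v B"] exI[of _ "l(v := c)"]) auto
  qed
qed

lemma self_adjoint_eigenbasis:
  assumes "self_adjoint f"
  obtains B l where "finite B" "pairwise orthogonal B"
    "\<And>b. b \<in> B \<Longrightarrow> norm b = 1" "\<And>b. b \<in> B \<Longrightarrow> f b = l b *\<^sub>R b" "span B = UNIV"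
  using self_adjoint_eigenbasis_subspace[OF assms subspace_UNIV] by auto

lemma psd_operator_sqrt_exists:
  assumes f: "psd_operator f"
  shows "\<exists>g. psd_operator g \<and> g \<circ> g = f"
proof -
  have lin: "linear f" and sa: "self_adjoint f" and pos: "\<And>x. 0 \<le> inner x (f x)"
    using f by (auto simp: psd_operator_def self_adjoint_def)
  obtain B l where B: "finite B" "pairwise orthogonal B" and nrm: "\<And>b. b \<in> B \<Longrightarrow> norm b = 1"
    and ev: "\<And>b. b \<in> B \<Longrightarrow> f b = l b *\<^sub>R b" and span: "span B = UNIV"
    using self_adjoint_eigenbasis[OF sa] by blast
  have l: "0 \<le> l b" if "b \<in> B" for b
    using pos[of b] ev[OF that] nrm[OF that] by (simp add: dot_square_norm)
  define g where "g x = (\<Sum>b\<in>B. (sqrt (l b) * inner x b) *\<^sub>R b)" for x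
  have ling: "linear g"
    by (rule linearI) (simp_all add: g_def inner_add_left algebra_simps sum.distrib scaleR_sum_right)
  have gB: "g b = sqrt (l b) *\<^sub>R b" if b: "b \<in> B" for b
  proof -
    have "(\<Sum>c\<in>B. (sqrt (l c) * inner b c) *\<^sub>R c) = (\<Sum>c\<in>B. if c = b then sqrt (l b) *\<^sub>R b else 0)"
      using B(2) b nrm by (intro sum.cong) (auto simp: pairwise_def orthogonal_def dot_square_norm)
    then show ?thesis using B(1) b by (simp add: g_def)
  qed
  have "inner (g x) y = inner x (g y)" for x y
    by (simp add: g_def inner_sum_left inner_sum_right mult_ac inner_commute)
  moreover have "inner x (g x) = (\<Sum>b\<in>B. sqrt (l b) * (inner x b)\<^sup>2)" for x
    by (simp add: g_def inner_sum_right power2_eq_square mult_ac)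
  then have "0 \<le> inner x (g x)" for x
    using l by (auto intro!: sum_nonneg mult_nonneg_nonneg)
  ultimately have "psd_operator g"
    using ling by (simp add: psd_operator_def self_adjoint_def)
  moreover have "g \<circ> g = f"
  proof
    fix x
    have "x \<in> span B" by (simp add: span)
    then show "(g \<circ> g) x = f x"
      by (rule linear_eq_on[OF linear_compose[OF ling ling] lin])
        (simp add: gB ev linear_cmul[OF ling] l)
  qed
  ultimately show ?thesis by blast
qed

text \<open>On an eigenvector b of g with eigenvalue l, \<open>(h + l) (h - l) b = 0\<close>. The
  vector \<open>h b - l b\<close> would thus be an eigenvector of h for -l, which positivity forbids
  when l > 0; when l = 0, \<open>h (h b) = 0\<close> already forces \<open>h b = 0\<close>.\<close>

lemma psd_operator_sqrt_unique:
  assumes g: "psd_operator g" and h: "psd_operator h" and eq: "g \<circ> g = h \<circ> h"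
  shows "g = h"
proof -
  have ling: "linear g" and sa: "self_adjoint g" and posg: "\<And>x. 0 \<le> inner x (g x)"
    using g by (auto simp: psd_operator_def self_adjoint_def)
  have linh: "linear h" and adjh: "\<And>x y. inner (h x) y = inner x (h y)" and posh: "\<And>x. 0 \<le> inner x (h x)"
    using h by (auto simp: psd_operator_def self_adjoint_def)
  obtain B l where "finite B" "pairwise orthogonal B" and nrm: "\<And>b. b \<in> B \<Longrightarrow> norm b = 1"
    and ev: "\<And>b. b \<in> B \<Longrightarrow> g b = l b *\<^sub>R b" and span: "span B = UNIV"
    using self_adjoint_eigenbasis[OF sa] by blast
  have hB: "g b = h b" if b: "b \<in> B" for b
  proof -
    have l: "0 \<le> l b"
      using posg[of b] ev[OF b] nrm[OF b] by (simp add: dot_square_norm)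
    have hh: "h (h b) = (l b)\<^sup>2 *\<^sub>R b"
      using fun_cong[OF eq, of b] by (simp add: ev[OF b] linear_cmul[OF ling] power2_eq_square)
    define y where "y = h b - l b *\<^sub>R b"
    have hy: "h y = - l b *\<^sub>R y"
      by (simp add: y_def linear_diff[OF linh] linear_cmul[OF linh] hh algebra_simps power2_eq_square)
    have "y = 0"
    proof (cases "l b = 0")
      case True
      have "inner (h b) (h b) = 0" using adjh[of b "h b"] hh True by simp
      then show ?thesis by (simp add: y_def True)
    next
      case False
      have "l b * inner y y \<le> 0" using posh[of y] by (simp add: hy)
      then show ?thesis using False l by (simp add: mult_le_0_iff) (metis inner_ge_zero inner_eq_zero_iff order_antisym less_eq_real_def)
    qed
    then show ?thesis by (simp add: y_def ev[OF b])
  qed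
  show ?thesis
  proof
    fix x
    have "x \<in> span B" by (simp add: span)
    then show "g x = h x" by (rule linear_eq_on[OF ling linh]) (rule hB)
  qed
qed

section \<open>Square roots of Hermitian matrices\<close>

lemma herm_prod_matrix_adjoint:
  assumes "\<And>i j. A $ i $ j = cnj (A $ j $ i)"
  shows "herm_prod (A *v x) y = herm_prod x (A *v y)"
proof -
  have "herm_prod (A *v x) y = (\<Sum>i\<in>UNIV. \<Sum>j\<in>UNIV. cnj (x $ j) * A $ j $ i * y $ i)"
    unfolding herm_prod_def matrix_vector_mult_def vec_lambda_beta cnj_sum sum_distrib_right
    by (intro sum.cong refl) (simp add: assms[symmetric])
  also have "\<dots> = (\<Sum>j\<in>UNIV. \<Sum>i\<in>UNIV. cnj (x $ j) * A $ j $ i * y $ i)"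
    by (rule sum.swap)
  also have "\<dots> = herm_prod x (A *v y)"
    by (simp add: herm_prod_def matrix_vector_mult_def sum_distrib_left mult.assoc)
  finally show ?thesis .
qed

lemma herm_prod_axis_left: "herm_prod (axis i 1) x = x $ i"
proof -
  have "herm_prod (axis i 1) x = (\<Sum>k\<in>UNIV. if k = i then x $ i else 0)"
    unfolding herm_prod_def by (intro sum.cong) (auto simp: axis_def)
  then show ?thesis by simp
qed

lemma linear_complex_matrix: "linear ((*v) (A :: complex ^ 'n ^ 'n))"
  by (rule linearI)
    (simp_all only: matrix_vector_right_distrib vector_scalar_commute smult_complex_of_real[symmetric])

lemma matrix_axis_component: "((A :: complex ^ 'n ^ 'n) *v axis j 1) $ i = A $ i $ j"
proof -
  have "(A *v axis j 1) $ i = (\<Sum>k\<in>UNIV. if k = j then A $ i $ j else 0)"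
    unfolding matrix_vector_mult_def vec_lambda_beta by (intro sum.cong) (auto simp: axis_def)
  then show ?thesis by simp
qed

lemma herm_psd_adjoint:
  assumes "herm_psd A"
  shows "herm_prod (A *v x) y = herm_prod x (A *v y)"
  using assms unfolding herm_psd_def by (intro herm_prod_matrix_adjoint) blast

text \<open>The real inner product sees only real parts. Testing self-adjointness against
  \<open>\<i> *s y\<close> as well recovers the imaginary part.\<close>

lemma herm_psd_iff_psd_operator: "herm_psd A \<longleftrightarrow> psd_operator ((*v) A)"
proof
  assume A: "herm_psd A"
  have "0 \<le> Re (herm_prod x (A *v x))" for x
    using A unfolding herm_psd_def by blast
  then show "psd_operator ((*v) A)"
    by (simp add: psd_operator_def self_adjoint_def linear_complex_matrix inner_eq_Re_herm_prod
        herm_psd_adjoint[OF A])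
next
  assume A: "psd_operator ((*v) A)"
  then have adj: "Re (herm_prod (A *v x) y) = Re (herm_prod x (A *v y))" for x y
    by (simp add: psd_operator_def self_adjoint_def inner_eq_Re_herm_prod)
  have "herm_prod (A *v x) y = herm_prod x (A *v y)" for x y
  proof (rule complex_eqI)
    show "Re (herm_prod (A *v x) y) = Re (herm_prod x (A *v y))" by (rule adj)
    show "Im (herm_prod (A *v x) y) = Im (herm_prod x (A *v y))"
      using adj[of x "\<i> *s y"] by (simp add: vector_scalar_commute herm_prod_scale_right)
  qed
  then have "herm_prod (A *v axis i 1) (axis j 1) = (A *v axis j 1) $ i" for i j
    by (simp add: herm_prod_axis_left)
  then have "cnj (herm_prod (axis j 1) (A *v axis i 1)) = (A *v axis j 1) $ i" for i j
    by (simp add: cnj_herm_prod)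
  then have "cnj (A $ j $ i) = A $ i $ j" for i j
    by (simp add: herm_prod_axis_left matrix_axis_component)
  moreover have "0 \<le> Re (herm_prod x (A *v x))" for x
    using A by (simp add: psd_operator_def inner_eq_Re_herm_prod)
  ultimately show "herm_psd A" by (simp add: herm_psd_def)
qed

text \<open>The square root provided by the real spectral theorem commutes with multiplication by the
  imaginary unit: its conjugate by that multiplication is again a positive semidefinite square root.\<close>

lemma herm_psd_sqrt_exists:
  assumes A: "herm_psd A"
  shows "\<exists>S. herm_psd S \<and> S ** S = A"
proof -
  let ?f = "(*v) A"
  obtain g where g: "psd_operator g" and gg: "g \<circ> g = ?f"
    using psd_operator_sqrt_exists A herm_psd_iff_psd_operator by blast
  have ling: "linear g" and adj: "\<And>x y. inner (g x) y = inner x (g y)" and pos: "\<And>x. 0 \<le> inner x (g x)"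
    using g by (auto simp: psd_operator_def self_adjoint_def)
  have ggx: "g (g x) = A *v x" for x using fun_cong[OF gg, of x] by simp
  have J: "inner x ((- \<i>) *s y) = inner (\<i> *s x) y" "inner ((- \<i>) *s x) y = inner x (\<i> *s y)" for x y :: "complex ^ 'a"
    by (simp_all only: inner_eq_Re_herm_prod herm_prod_scale_left herm_prod_scale_right complex_cnj_minus complex_cnj_i minus_minus)
  define h where "h x = (- \<i>) *s g (\<i> *s x)" for x
  have linJ: "linear (\<lambda>x :: complex ^ 'a. c *s x)" for c
    by (rule linearI) (auto simp: vec_eq_iff algebra_simps scaleR_conv_of_real[where 'a=complex])
  have "linear h"
    using linear_compose[OF linear_compose[OF linJ ling] linJ] unfolding h_def[abs_def] comp_def .
  moreover have "inner (h x) y = inner x (h y)" for x y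
    unfolding h_def J adj ..
  moreover have "0 \<le> inner x (h x)" for x
    unfolding h_def J by (rule pos)
  ultimately have "psd_operator h" by (simp add: psd_operator_def self_adjoint_def)
  moreover have "h \<circ> h = g \<circ> g"
    by (auto simp: h_def fun_eq_iff ggx vector_scalar_commute simp del: vector_sneg_minus1)
  ultimately have "h = g" using psd_operator_sqrt_unique g by blast
  then have gi: "g (\<i> *s x) = \<i> *s g x" for x
  proof -
    have "\<i> *s h x = g (\<i> *s x)" by (simp add: h_def vec_eq_iff)
    then show ?thesis using \<open>h = g\<close> by simp
  qed
  \<comment> \<open>Commuting with the imaginary unit upgrades real linearity to complex linearity,
    which is what makes \<open>g\<close> the action of a complex matrix.\<close>
  have gc: "g (c *s x) = c *s g x" for c x
  proof -
    have *: "c *s y = Re c *\<^sub>R y + Im c *\<^sub>R (\<i> *s y)" for y :: "complex ^ 'a"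
      by (simp add: vec_eq_iff complex_eq_iff)
    show ?thesis
      by (simp only: *[of x] *[of "g x"] linear_add[OF ling] linear_cmul[OF ling] gi)
  qed
  have "Vector_Spaces.linear (*s) (*s) g"
    by (simp add: Vector_Spaces.linear_iff vec.vector_space_axioms linear_add[OF ling] gc)
  then have m: "(*v) (matrix g) = g" by (auto simp: matrix_works)
  then have "herm_psd (matrix g)" by (simp add: herm_psd_iff_psd_operator g)
  moreover have "matrix g ** matrix g = A"
    by (simp add: matrix_eq matrix_vector_mul_assoc[symmetric] m ggx)
  ultimately show ?thesis by blast
qed

lemma herm_psd_sqrt_unique:
  assumes "herm_psd S" "herm_psd T" "S ** S = T ** T"
  shows "S = T"
proof -
  have "(*v) S \<circ> (*v) S = (*v) T \<circ> (*v) T"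
    using assms(3) by (simp add: fun_eq_iff matrix_vector_mul_assoc)
  then have "(*v) S = (*v) T"
    using psd_operator_sqrt_unique assms(1,2) herm_psd_iff_psd_operator by blast
  then show ?thesis by (simp add: matrix_eq)
qed

lemma psd_sqrt:
  assumes "herm_psd A"
  shows "herm_psd (psd_sqrt A)" "psd_sqrt A ** psd_sqrt A = A"
proof -
  have "\<exists>!S. herm_psd S \<and> S ** S = A"
    using herm_psd_sqrt_exists[OF assms] herm_psd_sqrt_unique by blast
  from theI'[OF this] show "herm_psd (psd_sqrt A)" "psd_sqrt A ** psd_sqrt A = A"
    by (auto simp: psd_sqrt_def)
qed

lemma herm_prod_psd_sqrt:
  assumes "herm_psd A"
  shows "herm_prod x (psd_sqrt A *v y) = herm_prod (psd_sqrt A *v x) y"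
  by (rule herm_psd_adjoint[OF psd_sqrt(1)[OF assms], symmetric])

text \<open>Each channel entry becomes a projection of the white vector onto a column of the root. A
  unit diagonal of \<open>A\<close> makes these columns unit vectors, so the results on Gaussian
  projections apply.\<close>

lemma psd_sqrt_component:
  assumes "herm_psd A"
  shows "(psd_sqrt A *v u) $ i = herm_prod (psd_sqrt A *v axis i 1) u"
  using herm_prod_psd_sqrt[OF assms, of "axis i 1" u] by (simp add: herm_prod_axis_left)

lemma norm_psd_sqrt_axis:
  assumes "herm_psd A"
  shows "(norm (psd_sqrt A *v axis i 1))\<^sup>2 = Re (A $ i $ i)"
  unfolding norm_sq_eq_Re_herm_prod herm_prod_psd_sqrt[OF assms, symmetric]
  by (simp add: matrix_vector_mul_assoc psd_sqrt(2)[OF assms] herm_prod_axis_left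
      matrix_axis_component)

section \<open>Positive semidefinite kernels\<close>

definition psd_kernel :: "('n::finite \<Rightarrow> 'n \<Rightarrow> real) \<Rightarrow> bool" where
  "psd_kernel K \<longleftrightarrow> (\<forall>i j. K i j = K j i) \<and> (\<forall>x. 0 \<le> (\<Sum>i\<in>UNIV. \<Sum>j\<in>UNIV. x i * x j * K i j))"

lemma psd_kernelI:
  assumes "\<And>i j. K i j = K j i" "\<And>x. 0 \<le> (\<Sum>i\<in>UNIV. \<Sum>j\<in>UNIV. x i * x j * K i j)"
  shows "psd_kernel K"
  using assms unfolding psd_kernel_def by blast

lemma psd_kernel_sym: "psd_kernel K \<Longrightarrow> K i j = K j i"
  and psd_kernel_nonneg: "psd_kernel K \<Longrightarrow> 0 \<le> (\<Sum>i\<in>UNIV. \<Sum>j\<in>UNIV. x i * x j * K i j)"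
  unfolding psd_kernel_def by blast+

lemma psd_kernel_gram:
  fixes v :: "'n::finite \<Rightarrow> 'a::real_inner"
  shows "psd_kernel (\<lambda>i j. inner (v i) (v j))"
proof (rule psd_kernelI)
  fix x :: "'n \<Rightarrow> real"
  have "(\<Sum>i\<in>UNIV. \<Sum>j\<in>UNIV. x i * x j * inner (v i) (v j))
      = inner (\<Sum>i\<in>UNIV. x i *\<^sub>R v i) (\<Sum>j\<in>UNIV. x j *\<^sub>R v j)"
    by (subst sum.swap) (simp add: inner_sum_left inner_sum_right sum_distrib_left mult_ac)
  then show "0 \<le> (\<Sum>i\<in>UNIV. \<Sum>j\<in>UNIV. x i * x j * inner (v i) (v j))" by simp
qed (rule inner_commute)

text \<open>The vectors are the images of the coordinate axes under the operator square
  root.\<close>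

lemma psd_kernel_imp_gram:
  fixes K :: "'n::finite \<Rightarrow> 'n \<Rightarrow> real"
  assumes "psd_kernel K"
  shows "\<exists>v :: 'n \<Rightarrow> real ^ 'n. \<forall>i j. K i j = inner (v i) (v j)"
proof -
  define f :: "real ^ 'n \<Rightarrow> real ^ 'n" where "f x = (\<chi> i. \<Sum>j\<in>UNIV. K i j * x $ j)" for x
  have 1: "linear f"
    by (rule linearI) (simp_all add: f_def vec_eq_iff algebra_simps sum.distrib sum_distrib_left)
  have 2: "inner x (f y) = (\<Sum>i\<in>UNIV. \<Sum>j\<in>UNIV. x $ i * y $ j * K i j)" for x y
    by (simp add: f_def inner_vec_def sum_distrib_left mult_ac)
  have "inner y (f x) = (\<Sum>i\<in>UNIV. \<Sum>j\<in>UNIV. x $ i * y $ j * K i j)" for x y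
    unfolding 2 by (subst sum.swap) (simp add: psd_kernel_sym[OF assms] mult_ac)
  then have "inner (f x) y = inner x (f y)" for x y
    by (simp add: inner_commute[of "f x"] 2)
  then have "psd_operator f"
    using psd_kernel_nonneg[OF assms] by (simp add: psd_operator_def self_adjoint_def 1 2)
  then obtain g where g: "psd_operator g" "g \<circ> g = f" using psd_operator_sqrt_exists by blast
  have "inner (g (axis i 1)) (g (axis j 1)) = K i j" for i j
  proof -
    have "inner (g (axis i 1)) (g (axis j 1)) = inner (axis i 1) (f (axis j 1))"
      using g by (auto simp: psd_operator_def self_adjoint_def)
    also have "\<dots> = f (axis j 1) $ i" by (simp add: inner_axis')
    also have "\<dots> = (\<Sum>k\<in>UNIV. if k = j then K i j else 0)"
      unfolding f_def vec_lambda_beta by (intro sum.cong) (auto simp: axis_def)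
    finally show ?thesis by simp
  qed
  then show ?thesis by (intro exI[of _ "\<lambda>i. g (axis i 1)"]) simp
qed

text \<open>Schur's product theorem. With K as a Gram matrix, the quadratic form splits over the
  coordinates k into forms of L with weights \<open>x i * v i $ k\<close>.\<close>

lemma psd_kernel_mult:
  fixes K L :: "'n::finite \<Rightarrow> 'n \<Rightarrow> real"
  assumes K: "psd_kernel K" and L: "psd_kernel L"
  shows "psd_kernel (\<lambda>i j. K i j * L i j)"
proof (rule psd_kernelI)
  fix x :: "'n \<Rightarrow> real"
  obtain v :: "'n \<Rightarrow> real ^ 'n" where v: "\<And>i j. K i j = inner (v i) (v j)"
    using psd_kernel_imp_gram[OF K] by blast
  have "(\<Sum>i\<in>UNIV. \<Sum>j\<in>UNIV. x i * x j * (K i j * L i j))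
      = (\<Sum>i\<in>UNIV. \<Sum>j\<in>UNIV. \<Sum>k\<in>UNIV. (x i * v i $ k) * (x j * v j $ k) * L i j)"
    by (simp add: v inner_vec_def sum_distrib_left sum_distrib_right mult_ac)
  also have "\<dots> = (\<Sum>i\<in>UNIV. \<Sum>k\<in>UNIV. \<Sum>j\<in>UNIV. (x i * v i $ k) * (x j * v j $ k) * L i j)"
    by (intro sum.cong refl sum.swap)
  also have "\<dots> = (\<Sum>k\<in>UNIV. \<Sum>i\<in>UNIV. \<Sum>j\<in>UNIV. (x i * v i $ k) * (x j * v j $ k) * L i j)"
    by (rule sum.swap)
  also have "\<dots> \<ge> 0" by (intro sum_nonneg psd_kernel_nonneg[OF L])
  finally show "0 \<le> (\<Sum>i\<in>UNIV. \<Sum>j\<in>UNIV. x i * x j * (K i j * L i j))" .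
qed (simp add: psd_kernel_sym[OF K] psd_kernel_sym[OF L])

lemma psd_kernel_add:
  assumes "psd_kernel K" "psd_kernel L"
  shows "psd_kernel (\<lambda>i j. K i j + L i j)"
proof (rule psd_kernelI)
  show "0 \<le> (\<Sum>i\<in>UNIV. \<Sum>j\<in>UNIV. x i * x j * (K i j + L i j))" for x
    using psd_kernel_nonneg[OF assms(1), of x] psd_kernel_nonneg[OF assms(2), of x]
    by (simp add: distrib_left sum.distrib)
qed (metis assms psd_kernel_sym)

lemma psd_kernel_cmult:
  assumes "psd_kernel K" "0 \<le> c"
  shows "psd_kernel (\<lambda>i j. c * K i j)"
proof (rule psd_kernelI)
  fix x
  have "(\<Sum>i\<in>UNIV. \<Sum>j\<in>UNIV. x i * x j * (c * K i j)) = c * (\<Sum>i\<in>UNIV. \<Sum>j\<in>UNIV. x i * x j * K i j)"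
    by (simp add: sum_distrib_left mult_ac)
  then show "0 \<le> (\<Sum>i\<in>UNIV. \<Sum>j\<in>UNIV. x i * x j * (c * K i j))"
    using assms psd_kernel_nonneg[OF assms(1), of x] by simp
qed (metis assms(1) psd_kernel_sym)

lemma psd_kernel_rescale:
  assumes "psd_kernel K"
  shows "psd_kernel (\<lambda>i j. f i * f j * K i j)"
proof (rule psd_kernelI)
  show "0 \<le> (\<Sum>i\<in>UNIV. \<Sum>j\<in>UNIV. x i * x j * (f i * f j * K i j))" for x
    using psd_kernel_nonneg[OF assms, of "\<lambda>i. x i * f i"] by (simp add: mult_ac)
qed (metis assms psd_kernel_sym mult.commute)

lemma psd_kernel_power:
  assumes "psd_kernel K"
  shows "psd_kernel (\<lambda>i j. K i j ^ n)"
proof (induction n)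
  case 0
  show ?case using psd_kernel_gram[of "\<lambda>_. 1 :: real"] by simp
next
  case (Suc n)
  show ?case using psd_kernel_mult[OF assms Suc] by simp
qed

lemma psd_kernel_limit:
  assumes "\<And>n. psd_kernel (K n)" "\<And>i j. (\<lambda>n. K n i j) \<longlonglongrightarrow> L i j"
  shows "psd_kernel L"
proof (rule psd_kernelI)
  show "0 \<le> (\<Sum>i\<in>UNIV. \<Sum>j\<in>UNIV. x i * x j * L i j)" for x
  proof (rule LIMSEQ_le_const)
    show "(\<lambda>n. \<Sum>i\<in>UNIV. \<Sum>j\<in>UNIV. x i * x j * K n i j) \<longlonglongrightarrow> (\<Sum>i\<in>UNIV. \<Sum>j\<in>UNIV. x i * x j * L i j)"
      by (intro tendsto_sum tendsto_mult tendsto_const assms(2))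
  qed (auto intro: psd_kernel_nonneg assms(1))
  fix i j
  have "(\<lambda>n. K n i j) = (\<lambda>n. K n j i)" using assms(1) psd_kernel_sym by metis
  then show "L i j = L j i" using assms(2)[of i j] assms(2)[of j i] LIMSEQ_unique by metis
qed

text \<open>The Taylor coefficients are nonnegative, so every partial sum is a nonnegative
  combination of Schur powers.\<close>

lemma psd_kernel_exp:
  assumes "psd_kernel K"
  shows "psd_kernel (\<lambda>i j. exp (K i j))"
proof (rule psd_kernel_limit)
  show "psd_kernel (\<lambda>i j. \<Sum>k<n. inverse (fact k) * K i j ^ k)" for n
  proof (induction n)
    case 0
    show ?case by (rule psd_kernelI) auto
  next
    case (Suc n)
    show ?case
      using psd_kernel_add[OF Suc psd_kernel_cmult[OF psd_kernel_power[OF assms, of n], of "inverse (fact n)"]]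
      by simp
  qed
  show "(\<lambda>n. \<Sum>k<n. inverse (fact k) * K i j ^ k) \<longlonglongrightarrow> exp (K i j)" for i j
    using exp_converges[of "K i j"] by (simp add: sums_def)
qed

text \<open>Expanding the squared distance leaves the exponential of a Gram kernel, rescaled by one
  factor for each index.\<close>

lemma psd_kernel_gaussian:
  fixes p :: "'n::finite \<Rightarrow> 'a::real_inner"
  shows "psd_kernel (\<lambda>i j. exp (- w\<^sup>2 * (dist (p i) (p j))\<^sup>2))"
proof -
  have "psd_kernel (\<lambda>i j. exp (- w\<^sup>2 * (norm (p i))\<^sup>2) * exp (- w\<^sup>2 * (norm (p j))\<^sup>2) *
      exp (2 * w\<^sup>2 * inner (p i) (p j)))"
    by (intro psd_kernel_rescale psd_kernel_exp psd_kernel_cmult psd_kernel_gram) auto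
  also have "(\<lambda>i j. exp (- w\<^sup>2 * (norm (p i))\<^sup>2) * exp (- w\<^sup>2 * (norm (p j))\<^sup>2) * exp (2 * w\<^sup>2 * inner (p i) (p j)))
      = (\<lambda>i j. exp (- w\<^sup>2 * (dist (p i) (p j))\<^sup>2))"
    by (simp add: dist_norm power2_norm_eq_inner inner_diff_left inner_diff_right inner_commute
        algebra_simps flip: exp_add)
  finally show ?thesis .
qed

section \<open>Distances as mixtures of Gaussian kernels\<close>

lemma integrable_one_minus_gaussian:
  "integrable lborel (\<lambda>w::real. (1 - exp (- w\<^sup>2)) / w\<^sup>2)"
proof (rule Bochner_Integration.integrable_bound)
  show "integrable lborel (\<lambda>w::real. 2 * inverse (1 + w\<^sup>2))"
    using integrable_inverse_1_plus_square by (simp add: set_integrable_def)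
  \<comment> \<open>With \<open>t = w^2\<close>, the numerator is at most t, which controls the
    origin, and at most 1, which controls infinity. The sum of both bounds gives the majorant; at w
    = 0 the quotient is 0 by convention.\<close>
  show "AE w in (lborel :: real measure). norm ((1 - exp (- w\<^sup>2)) / w\<^sup>2) \<le> norm (2 * inverse (1 + w\<^sup>2))"
  proof (rule AE_I2)
    fix w :: real
    define t where "t = w\<^sup>2"
    have t: "t \<ge> 0" by (simp add: t_def)
    have "1 - exp (- t) \<le> t" using exp_ge_add_one_self[of "- t"] by simp
    moreover have "t * (1 - exp (- t)) \<le> t" using t by (simp add: mult_left_le)
    ultimately have "(1 - exp (- t)) * (1 + t) \<le> 2 * t" by (simp add: algebra_simps)
    then show "norm ((1 - exp (- w\<^sup>2)) / w\<^sup>2) \<le> norm (2 * inverse (1 + w\<^sup>2))"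
      unfolding t_def[symmetric] using t
      by (cases "t = 0") (auto simp: field_simps abs_mult)
  qed
qed measurable

text \<open>This constant is divided out of an inequality, so its sign decides the
  direction.\<close>

lemma integral_one_minus_gaussian_pos:
  "0 < (\<integral>w. (1 - exp (- w\<^sup>2)) / w\<^sup>2 \<partial>(lborel :: real measure))" (is "0 < ?C")
proof -
  have nn: "0 \<le> (1 - exp (- w\<^sup>2)) / w\<^sup>2" for w :: real by simp
  have "?C \<noteq> 0"
  proof
    assume "?C = 0"
    then have "AE w in lborel. (1 - exp (- w\<^sup>2)) / w\<^sup>2 = (0 :: real)"
      using integral_nonneg_eq_0_iff_AE[OF integrable_one_minus_gaussian] nn by simp
    moreover have "AE w in lborel. w \<noteq> (0 :: real)" by (rule AE_lborel_singleton)
    ultimately have "AE w in (lborel :: real measure). False"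
      by eventually_elim auto
    then show False by (simp add: eventually_False ae_filter_eq_bot_iff)
  qed
  moreover have "0 \<le> ?C" by (intro integral_nonneg_AE AE_I2 nn)
  ultimately show ?thesis by linarith
qed

lemma has_bochner_integral_one_minus_gaussian_scaled:
  fixes r :: real
  assumes "0 \<le> r"
  shows "has_bochner_integral lborel (\<lambda>w. (1 - exp (- w\<^sup>2 * r\<^sup>2)) / w\<^sup>2)
     (r * (\<integral>w. (1 - exp (- w\<^sup>2)) / w\<^sup>2 \<partial>(lborel :: real measure)))"
proof (cases "r = 0")
  case False
  let ?f = "\<lambda>w::real. (1 - exp (- w\<^sup>2)) / w\<^sup>2"
  have "has_bochner_integral lborel ?f (\<integral>w. ?f w \<partial>lborel)"
    using integrable_one_minus_gaussian by (simp add: has_bochner_integral_iff)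
  then have "has_bochner_integral lborel (\<lambda>w. ?f (0 + r * w)) ((\<integral>w. ?f w \<partial>lborel) /\<^sub>R \<bar>r\<bar>)"
    using lborel_has_bochner_integral_real_affine_iff[OF False, of ?f _ 0] by blast
  then have "has_bochner_integral lborel (\<lambda>w. r\<^sup>2 * ?f (0 + r * w)) (r\<^sup>2 * ((\<integral>w. ?f w \<partial>lborel) /\<^sub>R \<bar>r\<bar>))"
    by (intro has_bochner_integral_mult_right)
  moreover have "(\<lambda>w. r\<^sup>2 * ?f (0 + r * w)) = (\<lambda>w. (1 - exp (- w\<^sup>2 * r\<^sup>2)) / w\<^sup>2)"
    using False by (auto simp: fun_eq_iff power_mult_distrib mult.commute)
  moreover have "r\<^sup>2 * ((\<integral>w. ?f w \<partial>lborel) /\<^sub>R \<bar>r\<bar>) = r * (\<integral>w. ?f w \<partial>lborel)"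
    using assms False by (simp add: power2_eq_square)
  ultimately show ?thesis by metis
qed (simp add: has_bochner_integral_zero)

text \<open>A distance is a mixture \<open>d = C\<^sup>-\<^sup>1 \<integral> (1 - exp (- w\<^sup>2 d\<^sup>2)) / w\<^sup>2 dw\<close> of negated Gaussian
  kernels, up to constants that do not contribute when the weights sum to zero.\<close>

lemma dist_conditionally_negative:
  fixes p :: "'n::finite \<Rightarrow> 'a::real_inner"
  assumes "(\<Sum>i\<in>UNIV. x i) = 0"
  shows "(\<Sum>i\<in>UNIV. \<Sum>j\<in>UNIV. x i * x j * dist (p i) (p j)) \<le> 0"
proof -
  define C where "C = (\<integral>w. (1 - exp (- w\<^sup>2)) / w\<^sup>2 \<partial>(lborel :: real measure))"
  let ?g = "\<lambda>w d. (1 - exp (- w\<^sup>2 * d\<^sup>2)) / w\<^sup>2 :: real"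
  have "has_bochner_integral lborel (\<lambda>w. \<Sum>i\<in>UNIV. \<Sum>j\<in>UNIV. x i * x j * ?g w (dist (p i) (p j)))
     (\<Sum>i\<in>UNIV. \<Sum>j\<in>UNIV. x i * x j * (dist (p i) (p j) * C))"
    unfolding C_def
    by (intro has_bochner_integral_sum has_bochner_integral_mult_right
        has_bochner_integral_one_minus_gaussian_scaled zero_le_dist)
  then have I: "(\<integral>w. (\<Sum>i\<in>UNIV. \<Sum>j\<in>UNIV. x i * x j * ?g w (dist (p i) (p j))) \<partial>lborel)
      = (\<Sum>i\<in>UNIV. \<Sum>j\<in>UNIV. x i * x j * (dist (p i) (p j) * C))"
    by (rule has_bochner_integral_integral_eq)
  have "(\<Sum>i\<in>UNIV. \<Sum>j\<in>UNIV. x i * x j * ?g w (dist (p i) (p j))) \<le> 0" for w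
  proof -
    have "(\<Sum>i\<in>UNIV. \<Sum>j\<in>UNIV. x i * x j * ?g w (dist (p i) (p j)))
        = ((\<Sum>i\<in>UNIV. \<Sum>j\<in>UNIV. x i * x j)
            - (\<Sum>i\<in>UNIV. \<Sum>j\<in>UNIV. x i * x j * exp (- w\<^sup>2 * (dist (p i) (p j))\<^sup>2))) / w\<^sup>2"
      by (simp add: right_diff_distrib diff_divide_distrib sum_subtractf sum_divide_distrib)
    also have "(\<Sum>i\<in>UNIV. \<Sum>j\<in>UNIV. x i * x j) = 0"
      using assms by (simp add: sum_product[symmetric])
    finally show ?thesis
      using psd_kernel_nonneg[OF psd_kernel_gaussian[of w p], of x] by (simp add: divide_nonpos_nonneg)
  qed
  then have "0 \<le> (\<integral>w. - (\<Sum>i\<in>UNIV. \<Sum>j\<in>UNIV. x i * x j * ?g w (dist (p i) (p j))) \<partial>lborel)"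
    by (intro integral_nonneg_AE AE_I2) (simp only: neg_0_le_iff_le)
  then have "(\<integral>w. (\<Sum>i\<in>UNIV. \<Sum>j\<in>UNIV. x i * x j * ?g w (dist (p i) (p j))) \<partial>lborel) \<le> 0"
    by (simp only: Bochner_Integration.integral_minus neg_0_le_iff_le)
  then have "C * (\<Sum>i\<in>UNIV. \<Sum>j\<in>UNIV. x i * x j * dist (p i) (p j)) \<le> 0"
    unfolding I by (simp add: sum_distrib_left mult_ac)
  then show ?thesis
    using integral_one_minus_gaussian_pos by (simp add: C_def mult_le_0_iff)
qed

lemma psd_kernel_schoenberg:
  fixes p :: "'n::finite \<Rightarrow> 'a::real_inner"
  shows "psd_kernel (\<lambda>i j. dist (p i) (p k) + dist (p j) (p k) - dist (p i) (p j))"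
proof (rule psd_kernelI)
  fix x :: "'n \<Rightarrow> real"
  let ?d = "\<lambda>i j. dist (p i) (p j)"
  define s where "s = (\<Sum>i\<in>UNIV. x i)"
  \<comment> \<open>The total weight is compensated at the base point k, so that the weights sum to
    zero. As k has distance 0 from itself, the quadratic form changes by exactly
    \<open>2 * s * D\<close>.\<close>
  define y where "y i = x i - (if i = k then s else 0)" for i
  define D where "D = (\<Sum>i\<in>UNIV. x i * ?d i k)"
  have "(\<Sum>i\<in>UNIV. y i) = 0" by (simp add: y_def sum_subtractf s_def)
  then have *: "(\<Sum>i\<in>UNIV. \<Sum>j\<in>UNIV. y i * y j * ?d i j) \<le> 0"
    by (rule dist_conditionally_negative)
  have in1: "(\<Sum>j\<in>UNIV. y j * ?d i j) = (\<Sum>j\<in>UNIV. x j * ?d i j) - s * ?d i k" for i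
  proof -
    have "(\<Sum>j\<in>UNIV. y j * ?d i j) = (\<Sum>j\<in>UNIV. x j * ?d i j) - (\<Sum>j\<in>UNIV. if j = k then s * ?d i k else 0)"
      unfolding sum_subtractf[symmetric] by (intro sum.cong) (auto simp: y_def algebra_simps)
    then show ?thesis by simp
  qed
  have out: "(\<Sum>i\<in>UNIV. y i * f i) = (\<Sum>i\<in>UNIV. x i * f i) - s * f k" for f
  proof -
    have "(\<Sum>j\<in>UNIV. y j * f j) = (\<Sum>j\<in>UNIV. x j * f j) - (\<Sum>j\<in>UNIV. if j = k then s * f k else 0)"
      unfolding sum_subtractf[symmetric] by (intro sum.cong) (auto simp: y_def algebra_simps)
    then show ?thesis by simp
  qed
  have "(\<Sum>i\<in>UNIV. \<Sum>j\<in>UNIV. y i * y j * ?d i j) = (\<Sum>i\<in>UNIV. y i * (\<Sum>j\<in>UNIV. y j * ?d i j))"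
    by (simp add: sum_distrib_left mult.assoc)
  also have "\<dots> = (\<Sum>i\<in>UNIV. x i * ((\<Sum>j\<in>UNIV. x j * ?d i j) - s * ?d i k)) - s * D"
    unfolding in1 out by (simp add: D_def dist_commute)
  also have "\<dots> = (\<Sum>i\<in>UNIV. \<Sum>j\<in>UNIV. x i * x j * ?d i j) - 2 * s * D"
    by (simp add: right_diff_distrib sum_subtractf sum_distrib_left sum_negf D_def mult_ac)
  finally have "(\<Sum>i\<in>UNIV. \<Sum>j\<in>UNIV. x i * x j * ?d i j) \<le> 2 * s * D" using * by simp
  moreover have "(\<Sum>i\<in>UNIV. \<Sum>j\<in>UNIV. x i * x j * (?d i k + ?d j k - ?d i j))
      = 2 * s * D - (\<Sum>i\<in>UNIV. \<Sum>j\<in>UNIV. x i * x j * ?d i j)"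
  proof -
    have a: "(\<Sum>i\<in>UNIV. \<Sum>j\<in>UNIV. x i * x j * ?d i k) = D * s"
      by (simp only: D_def s_def sum_product) (simp add: mult_ac)
    have b: "(\<Sum>i\<in>UNIV. \<Sum>j\<in>UNIV. x i * x j * ?d j k) = s * D"
      by (simp only: D_def s_def sum_product) (simp add: mult_ac)
    show ?thesis
      unfolding right_diff_distrib distrib_left sum_subtractf sum.distrib a b by (simp add: mult_ac)
  qed
  ultimately show "0 \<le> (\<Sum>i\<in>UNIV. \<Sum>j\<in>UNIV. x i * x j * (?d i k + ?d j k - ?d i j))" by simp
qed (simp add: dist_commute)

text \<open>For any base point k the kernel is the exponential of a multiple of the Schoenberg
  kernel, rescaled by \<open>exp (- c * dist (p i) (p k))\<close> in each index.\<close>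

lemma psd_kernel_exp_neg_dist:
  fixes p :: "'n::finite \<Rightarrow> 'a::real_inner"
  assumes "0 \<le> c"
  shows "psd_kernel (\<lambda>i j. exp (- c * dist (p i) (p j)))"
proof -
  obtain k :: 'n where True by simp
  let ?d = "\<lambda>i j. dist (p i) (p j)"
  have "psd_kernel (\<lambda>i j. exp (- c * ?d i k) * exp (- c * ?d j k) * exp (c * (?d i k + ?d j k - ?d i j)))"
    by (intro psd_kernel_rescale psd_kernel_exp psd_kernel_cmult psd_kernel_schoenberg assms)
  then show ?thesis by (simp add: algebra_simps flip: exp_add)
qed

lemma herm_psd_of_real_kernel:
  fixes K :: "'n::finite \<Rightarrow> 'n \<Rightarrow> real"
  assumes "psd_kernel K"
  shows "herm_psd (\<chi> i j. complex_of_real (K i j))"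
  unfolding herm_psd_def
proof (intro conjI allI)
  fix i j
  show "(\<chi> i j. complex_of_real (K i j)) $ i $ j = cnj ((\<chi> i j. complex_of_real (K i j)) $ j $ i)"
    using psd_kernel_sym[OF assms, of i j] by simp
next
  fix x :: "complex ^ 'n"
  have "Re (herm_prod x ((\<chi> i j. complex_of_real (K i j)) *v x))
      = (\<Sum>i\<in>UNIV. \<Sum>j\<in>UNIV. Re (x $ i) * Re (x $ j) * K i j) + (\<Sum>i\<in>UNIV. \<Sum>j\<in>UNIV. Im (x $ i) * Im (x $ j) * K i j)"
    by (simp add: herm_prod_def matrix_vector_mult_def sum_distrib_left sum.distrib[symmetric] algebra_simps)
  then show "0 \<le> Re (herm_prod x ((\<chi> i j. complex_of_real (K i j)) *v x))"
    using psd_kernel_nonneg[OF assms, of "\<lambda>i. Re (x $ i)"] psd_kernel_nonneg[OF assms, of "\<lambda>i. Im (x $ i)"]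
    by simp
qed

lemma herm_psd_R_ru:
  assumes "0 \<le> \<rho>" "\<rho> \<le> 1" "0 < dr"
  shows "herm_psd (R_ru p dr \<rho>)"
proof (cases "\<rho> = 0")
  case True
  have "(mat 1 :: complex ^ 'a ^ 'a) *v x = x" for x by simp
  then show ?thesis
    using True by (auto simp: R_ru_def herm_psd_def herm_prod_self mat_def)
next
  case False
  \<comment> \<open>The decay rate \<open>- ln \<rho> / dr\<close> is nonnegative because \<rho> is
    at most 1.\<close>
  have "psd_kernel (\<lambda>i j. exp (- (- ln \<rho> / dr) * dist (p i) (p j)))"
    using assms False by (intro psd_kernel_exp_neg_dist) (simp add: divide_nonpos_pos)
  also have "(\<lambda>i j. exp (- (- ln \<rho> / dr) * dist (p i) (p j))) = (\<lambda>i j. \<rho> powr (dist (p i) (p j) / dr))"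
    using False by (simp add: powr_def mult.commute)
  finally show ?thesis
    using False herm_psd_of_real_kernel by (simp add: R_ru_def)
qed

section \<open>The optimal SNR\<close>

lemma R_ru_offdiag:
  assumes "i \<noteq> j" "0 \<le> \<rho>"
  shows "cmod (R_ru p dr \<rho> $ i $ j) = (if \<rho> = 0 then 0 else \<rho> powr (dist (p i) (p j) / dr))"
  using assms by (simp add: R_ru_def mat_def)

lemma R_ru_diag:
  assumes "0 \<le> \<rho>"
  shows "R_ru p dr \<rho> $ i $ i = 1"
  using assms by (simp add: R_ru_def mat_def)

lemma R_ru_offdiag_bounds:
  assumes "i \<noteq> j" "0 < dr" "0 \<le> \<rho>" "\<rho> \<le> 1"
  shows "(cmod (R_ru p dr \<rho> $ i $ j))\<^sup>2 \<in> {0..1}"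
  using assms by (auto simp: R_ru_offdiag powr_le1 power_le_one)

lemma F_sum_eq:
  assumes "0 < dr" "0 \<le> \<rho>" "\<rho> \<le> 1"
  shows "F_sum p dr \<rho> =
    (\<Sum>i\<in>UNIV. \<Sum>j\<in>UNIV - {i}. pi / 4 * euler_series ((cmod (R_ru p dr \<rho> $ i $ j))\<^sup>2))"
proof -
  have "hyp_term ((cmod (R_ru p dr \<rho> $ i $ j))\<^sup>2) = euler_series ((cmod (R_ru p dr \<rho> $ i $ j))\<^sup>2)"
    if "j \<in> UNIV - {i}" for i j
    using R_ru_offdiag_bounds[of i j, OF _ assms, of p] that
    by (intro hyp_term_eq_euler_series) auto
  then show ?thesis by (simp add: F_sum_def)
qed

lemma sum_offdiag_const:
  "(\<Sum>i\<in>(UNIV :: 'n::finite set). \<Sum>j\<in>UNIV - {i}. c) = real CARD('n) * (real CARD('n) - 1) * c"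
proof -
  have "0 < CARD('n)" by simp
  then show ?thesis by (simp add: card_Diff_singleton of_nat_diff Suc_leI)
qed

lemma F_sum_mono:
  assumes "0 < dr"
  shows "mono_on {0..1} (F_sum p dr)"
proof (rule mono_onI)
  fix r s :: real assume rs: "r \<in> {0..1}" "s \<in> {0..1}" "r \<le> s"
  have "euler_series ((cmod (R_ru p dr r $ i $ j))\<^sup>2) \<le> euler_series ((cmod (R_ru p dr s $ i $ j))\<^sup>2)"
    if j: "j \<in> UNIV - {i}" for i j
  proof (rule euler_series_mono)
    have ij: "i \<noteq> j" using j by auto
    show "(cmod (R_ru p dr r $ i $ j))\<^sup>2 \<le> (cmod (R_ru p dr s $ i $ j))\<^sup>2"
      using ij rs assms by (intro power_mono) (auto simp: R_ru_offdiag intro!: powr_mono2)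
    show "(cmod (R_ru p dr s $ i $ j))\<^sup>2 \<le> 1"
      using R_ru_offdiag_bounds[OF ij assms, of s p] rs by auto
  qed simp
  then have "(\<Sum>i\<in>UNIV. \<Sum>j\<in>UNIV - {i}. pi / 4 * euler_series ((cmod (R_ru p dr r $ i $ j))\<^sup>2))
      \<le> (\<Sum>i\<in>UNIV. \<Sum>j\<in>UNIV - {i}. pi / 4 * euler_series ((cmod (R_ru p dr s $ i $ j))\<^sup>2))"
    by (intro sum_mono mult_left_mono) simp_all
  then show "F_sum p dr r \<le> F_sum p dr s"
    using rs by (simp only: F_sum_eq[OF assms] atLeastAtMost_iff)
qed

lemma F_sum_bounds:
  fixes p :: "'n::finite \<Rightarrow> 'e::euclidean_space"
  assumes "0 < dr" "0 \<le> \<rho>" "\<rho> \<le> 1"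
  shows "real CARD('n) * (real CARD('n) - 1) * (pi / 4) \<le> F_sum p dr \<rho>"
    and "F_sum p dr \<rho> \<le> real CARD('n) * (real CARD('n) - 1)"
proof -
  have t: "1 \<le> euler_series ((cmod (R_ru p dr \<rho> $ i $ j))\<^sup>2)" "euler_series ((cmod (R_ru p dr \<rho> $ i $ j))\<^sup>2) \<le> 4 / pi"
    if "i \<noteq> j" for i j
    using euler_series_mono[of 0 "(cmod (R_ru p dr \<rho> $ i $ j))\<^sup>2"] euler_series_mono[of "(cmod (R_ru p dr \<rho> $ i $ j))\<^sup>2" 1]
      R_ru_offdiag_bounds[OF that assms, of p] by (auto simp: euler_series_0 euler_series_1)
  have "pi / 4 * 1 \<le> pi / 4 * euler_series ((cmod (R_ru p dr \<rho> $ i $ j))\<^sup>2)"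
    "pi / 4 * euler_series ((cmod (R_ru p dr \<rho> $ i $ j))\<^sup>2) \<le> pi / 4 * (4 / pi)" if "i \<noteq> j" for i j
    using t[OF that] by (intro mult_left_mono; simp)+
  note t' = this
  have "(\<Sum>i\<in>(UNIV :: 'n set). \<Sum>j\<in>UNIV - {i}. pi / 4 * 1) \<le> F_sum p dr \<rho>"
    unfolding F_sum_eq[OF assms] by (intro sum_mono t') auto
  moreover have "F_sum p dr \<rho> \<le> (\<Sum>i\<in>(UNIV :: 'n set). \<Sum>j\<in>UNIV - {i}. pi / 4 * (4 / pi))"
    unfolding F_sum_eq[OF assms] by (intro sum_mono t') auto
  ultimately show "real CARD('n) * (real CARD('n) - 1) * (pi / 4) \<le> F_sum p dr \<rho>"
    "F_sum p dr \<rho> \<le> real CARD('n) * (real CARD('n) - 1)"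
    unfolding sum_offdiag_const by simp_all
qed

lemma F_sum_0:
  fixes p :: "'n::finite \<Rightarrow> 'e::euclidean_space"
  assumes "0 < dr"
  shows "F_sum p dr 0 = real CARD('n) * (real CARD('n) - 1) * (pi / 4)"
proof -
  have "F_sum p dr 0 = (\<Sum>i\<in>(UNIV :: 'n set). \<Sum>j\<in>UNIV - {i}. pi / 4)"
    unfolding F_sum_eq[OF assms order_refl zero_le_one]
    by (intro sum.cong refl) (auto simp: R_ru_offdiag euler_series_0)
  then show ?thesis unfolding sum_offdiag_const .
qed

lemma F_sum_tendsto:
  fixes p :: "'n::finite \<Rightarrow> 'e::euclidean_space"
  assumes "0 < dr"
  shows "(F_sum p dr \<longlongrightarrow> real CARD('n) * (real CARD('n) - 1)) (at_left 1)"
proof -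
  have ev: "\<forall>\<^sub>F r in at_left 1. r \<in> {0<..<1::real}"
    by (rule eventually_at_left_real) simp
  have "((\<lambda>r. pi / 4 * euler_series ((cmod (R_ru p dr r $ i $ j))\<^sup>2)) \<longlongrightarrow> pi / 4 * euler_series 1) (at_left 1)"
    if ij: "i \<noteq> j" for i j
  proof (intro tendsto_mult tendsto_const continuous_on_tendsto_compose[OF continuous_on_euler_series])
    let ?a = "dist (p i) (p j) / dr"
    have "((\<lambda>r::real. (r powr ?a)\<^sup>2) \<longlongrightarrow> (1 powr ?a)\<^sup>2) (at_left 1)"
      by (intro tendsto_intros) auto
    moreover have eq: "\<forall>\<^sub>F r in at_left 1. (cmod (R_ru p dr r $ i $ j))\<^sup>2 = (r powr ?a)\<^sup>2"
      using ev by eventually_elim (simp add: R_ru_offdiag ij)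
    ultimately show "((\<lambda>r. (cmod (R_ru p dr r $ i $ j))\<^sup>2) \<longlongrightarrow> 1) (at_left 1)"
      unfolding tendsto_cong[OF eq] by simp
    show "\<forall>\<^sub>F r in at_left 1. (cmod (R_ru p dr r $ i $ j))\<^sup>2 \<in> {0..1}"
      using ev by eventually_elim (use R_ru_offdiag_bounds[OF ij assms, of _ p] in auto)
  qed auto
  then have "((\<lambda>r. \<Sum>i\<in>(UNIV :: 'n set). \<Sum>j\<in>UNIV - {i}. pi / 4 * euler_series ((cmod (R_ru p dr r $ i $ j))\<^sup>2))
      \<longlongrightarrow> (\<Sum>i\<in>(UNIV :: 'n set). \<Sum>j\<in>UNIV - {i}. pi / 4 * euler_series 1)) (at_left 1)"
    by (intro tendsto_sum) auto
  moreover have eq: "\<forall>\<^sub>F r in at_left 1. F_sum p dr r =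
      (\<Sum>i\<in>UNIV. \<Sum>j\<in>UNIV - {i}. pi / 4 * euler_series ((cmod (R_ru p dr r $ i $ j))\<^sup>2))"
    using ev by eventually_elim (simp add: F_sum_eq assms)
  ultimately show ?thesis
    unfolding sum_offdiag_const tendsto_cong[OF eq] by (simp add: euler_series_1)
qed

section \<open>Transfer to the underlying probability space\<close>

lemma std_complex_gaussian_distr:
  fixes u :: "'w \<Rightarrow> complex ^ 'n"
  assumes "std_complex_gaussian P u"
  shows "u \<in> borel_measurable P" "distr P borel u = std_gaussian"
proof -
  have d: "distributed P lborel u (\<lambda>z. ennreal (exp (- (norm z)\<^sup>2) / pi ^ CARD('n)))"
    using assms by (simp add: std_complex_gaussian_def)
  show "u \<in> borel_measurable P" using distributed_measurable[OF d] by simp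
  have "distr P borel u = distr P lborel u" by (simp cong: distr_cong)
  also have "\<dots> = std_gaussian"
    unfolding std_gaussian_def
    by (simp add: distributed_distr_eq_density[OF d] power_mult mult.commute[of _ 2])
  finally show "distr P borel u = std_gaussian" .
qed

lemma std_complex_gaussian_integral:
  fixes f :: "complex ^ 'n \<Rightarrow> real"
  assumes "std_complex_gaussian P u" "has_bochner_integral std_gaussian f m"
  shows "has_bochner_integral P (\<lambda>\<omega>. f (u \<omega>)) m"
proof -
  have [measurable]: "u \<in> borel_measurable P" by (rule std_complex_gaussian_distr[OF assms(1)])
  have [measurable]: "f \<in> borel_measurable borel"
    using borel_measurable_has_bochner_integral[OF assms(2)] by simp
  have "has_bochner_integral (distr P borel u) f m"
    unfolding std_complex_gaussian_distr[OF assms(1)] by (rule assms(2))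
  then show ?thesis
    by (simp add: has_bochner_integral_iff integrable_distr_eq integral_distr)
qed

text \<open>After composition with f and g both variables are real, and their events are among those
  of u and v. Preimage families are closed under intersection, so independence extends to the
  generated sigma-algebras and the product rule for means applies.\<close>

lemma indep_vectors_integral_mult:
  fixes P :: "'w measure" and f :: "complex ^ 'm \<Rightarrow> real" and g :: "complex ^ 'n \<Rightarrow> real"
  assumes "prob_space P" and indep: "indep_vectors P u v"
    and [measurable]: "u \<in> borel_measurable P" "v \<in> borel_measurable P"
      "f \<in> borel_measurable borel" "g \<in> borel_measurable borel"
    and f: "has_bochner_integral P (\<lambda>\<omega>. f (u \<omega>)) a" and g: "has_bochner_integral P (\<lambda>\<omega>. g (v \<omega>)) b"
  shows "has_bochner_integral P (\<lambda>\<omega>. f (u \<omega>) * g (v \<omega>)) (a * b)"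
proof -
  interpret prob_space P by fact
  let ?F = "{(\<lambda>\<omega>. f (u \<omega>)) -` A \<inter> space P | A. A \<in> sets borel}"
  let ?G = "{(\<lambda>\<omega>. g (v \<omega>)) -` A \<inter> space P | A. A \<in> sets borel}"
  have stable: "Int_stable {X -` A \<inter> space P | A. A \<in> sets borel}" for X :: "'w \<Rightarrow> real"
  proof (rule Int_stableI)
    fix a b assume "a \<in> {X -` A \<inter> space P | A. A \<in> sets borel}" "b \<in> {X -` A \<inter> space P | A. A \<in> sets borel}"
    then obtain A B where "a = X -` A \<inter> space P" "b = X -` B \<inter> space P" "A \<in> sets borel" "B \<in> sets borel"
      by blast
    then show "a \<inter> b \<in> {X -` A \<inter> space P | A. A \<in> sets borel}"
      by (intro CollectI exI[of _ "A \<inter> B"]) auto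
  qed
  have F: "?F \<subseteq> {u -` B \<inter> space P | B. B \<in> sets borel}"
  proof clarify
    fix A :: "real set" assume "A \<in> sets borel"
    then show "\<exists>B. (\<lambda>\<omega>. f (u \<omega>)) -` A \<inter> space P = u -` B \<inter> space P \<and> B \<in> sets borel"
      by (intro exI[of _ "f -` A"]) (auto intro: measurable_sets_borel[OF assms(5)])
  qed
  have G: "?G \<subseteq> {v -` B \<inter> space P | B. B \<in> sets borel}"
  proof clarify
    fix A :: "real set" assume "A \<in> sets borel"
    then show "\<exists>B. (\<lambda>\<omega>. g (v \<omega>)) -` A \<inter> space P = v -` B \<inter> space P \<and> B \<in> sets borel"
      by (intro exI[of _ "g -` A"]) (auto intro: measurable_sets_borel[OF assms(6)])
  qed
  note I = indep[unfolded indep_vectors_def indep_sets2_eq]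
  have "indep_set ?F ?G"
    unfolding indep_sets2_eq
  proof (intro conjI ballI)
    show "?F \<subseteq> events" by (rule subset_trans[OF F I[THEN conjunct1]])
    show "?G \<subseteq> events" by (rule subset_trans[OF G I[THEN conjunct2, THEN conjunct1]])
    show "prob (a \<inter> b) = prob a * prob b" if "a \<in> ?F" "b \<in> ?G" for a b
      using I[THEN conjunct2, THEN conjunct2, rule_format, OF subsetD[OF F that(1)] subsetD[OF G that(2)]] .
  qed
  then have "indep_set (sigma_sets (space P) ?F) (sigma_sets (space P) ?G)"
    by (intro indep_set_sigma_sets stable)
  then have ind: "indep_var borel (\<lambda>\<omega>. f (u \<omega>)) borel (\<lambda>\<omega>. g (v \<omega>))"
    unfolding indep_var_eq by simp
  show ?thesis
    using f g indep_var_integrable[OF ind] indep_var_lebesgue_integral[OF ind]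
    by (simp add: has_bochner_integral_iff)
qed

section \<open>Algebra of the phase-aligned channel\<close>

lemma cis_neg_Arg_mult: "cis (- Arg z) * z = of_real (cmod z)"
proof (cases "z = 0")
  case False
  have "z = of_real (cmod z) * cis (Arg z)"
    using rcis_cmod_Arg[of z] by (simp add: rcis_def)
  then have "cis (- Arg z) * z = of_real (cmod z) * (cis (- Arg z) * cis (Arg z))"
    by (metis mult.left_commute)
  then show ?thesis by (simp add: cis_mult)
qed simp

lemma cnj_mult_cis_Arg:
  assumes "cmod z = 1"
  shows "cnj z * cis (Arg z) = 1"
proof -
  have "z \<noteq> 0" using assms by auto
  then have "cis (Arg z) = z" by (simp add: cis_Arg sgn_eq assms)
  then show ?thesis using complex_norm_square[of z] by (simp add: assms mult.commute)
qed

lemma diag_mat_vector: "(diag_mat v *v x) $ i = v $ i * x $ i"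
proof -
  have "(diag_mat v *v x) $ i = (\<Sum>k\<in>UNIV. if k = i then v $ i * x $ i else 0)"
    unfolding matrix_vector_mult_def vec_lambda_beta diag_mat_def by (intro sum.cong) auto
  then show ?thesis by simp
qed

lemma mat_vector: "((mat c :: complex ^ 'n ^ 'n) *v x) $ i = c * x $ i"
  using diag_mat_vector[of "\<chi> i. c" x i] unfolding diag_mat_def mat_def vec_lambda_beta .

text \<open>The two diagonal phases cancel those of the steering vector and of the UE-RIS channel,
  so every path contributes its modulus along \<open>ab\<close>.\<close>

lemma global_channel_eq:
  assumes "\<And>k. cmod (ar $ k) = 1"
  shows "global_channel b ab ar xd xru
    = xd + (of_real (sqrt b * (\<Sum>k\<in>UNIV. cmod (xru $ k))) * phase_opt ab xd) *s ab"
proof -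
  have R: "(RIS_phase ab ar xd xru *v xru) $ k = phase_opt ab xd * (cis (Arg (ar $ k)) * of_real (cmod (xru $ k)))" for k
    unfolding RIS_phase_def matrix_vector_mul_assoc[symmetric] mat_vector diag_mat_vector
    by (simp add: cis_neg_Arg_mult)
  have H: "(H_br b ab ar *v y) $ i = (\<Sum>k\<in>UNIV. of_real (sqrt b) * ab $ i * (cnj (ar $ k) * y $ k))" for y i
    by (simp add: H_br_def matrix_vector_mult_def scaleR_conv_of_real[where 'a=complex] mult_ac)
  have "(H_br b ab ar *v (RIS_phase ab ar xd xru *v xru)) $ i
      = of_real (sqrt b * (\<Sum>k\<in>UNIV. cmod (xru $ k))) * phase_opt ab xd * ab $ i" for i
  proof -
    have "(H_br b ab ar *v (RIS_phase ab ar xd xru *v xru)) $ i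
      = (\<Sum>k\<in>UNIV. of_real (sqrt b) * ab $ i * phase_opt ab xd * ((cnj (ar $ k) * cis (Arg (ar $ k))) * of_real (cmod (xru $ k))))"
      unfolding H R by (simp add: mult_ac)
    also have "\<dots> = of_real (sqrt b) * ab $ i * phase_opt ab xd * (\<Sum>k\<in>UNIV. of_real (cmod (xru $ k)))"
      by (simp add: cnj_mult_cis_Arg assms sum_distrib_left)
    finally show ?thesis by (simp add: mult_ac)
  qed
  then show ?thesis by (simp add: global_channel_def vec_eq_iff)
qed

text \<open>The phase turns \<open>ab^H xd\<close> into its modulus in the cross term. Nonvanishing
  of that product ensures that the phase has modulus 1.\<close>

lemma norm_channel_sq:
  fixes xd ab :: "complex ^ 'm"
  assumes ab: "\<And>i. cmod (ab $ i) = 1" and w: "herm_prod ab xd \<noteq> 0" 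
  shows "(norm (xd + (of_real s * phase_opt ab xd) *s ab))\<^sup>2
    = (norm xd)\<^sup>2 + 2 * s * cmod (herm_prod ab xd) + s\<^sup>2 * real CARD('m)"
proof -
  let ?w = "herm_prod ab xd" and ?f = "phase_opt ab xd"
  have abab: "herm_prod ab ab = of_nat CARD('m)"
    unfolding herm_prod_def using complex_norm_square[of "ab $ i" for i] ab by (simp add: mult.commute)
  have fw: "cnj ?f * ?w = of_real (cmod ?w)"
  proof -
    have "cnj ?f * ?w = (?w * cnj ?w) / of_real (cmod ?w)"
      by (simp add: phase_opt_def mult.commute)
    also have "\<dots> = of_real ((cmod ?w)\<^sup>2) / of_real (cmod ?w)"
      by (simp only: complex_norm_square)
    also have "\<dots> = of_real (cmod ?w)"
      using w by (simp add: power2_eq_square)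
    finally show ?thesis .
  qed
  have ff: "cnj ?f * ?f = 1"
    using w complex_norm_square[of ?f] by (simp add: phase_opt_def norm_divide mult.commute)
  have fw': "?f * cnj ?w = of_real (cmod ?w)"
    using arg_cong[OF fw, of cnj] by simp
  have "herm_prod (xd + (of_real s * ?f) *s ab) (xd + (of_real s * ?f) *s ab)
      = herm_prod xd xd + of_real s * (?f * cnj ?w) + of_real s * (cnj ?f * ?w)
        + (of_real s)\<^sup>2 * (cnj ?f * ?f) * herm_prod ab ab"
    unfolding herm_prod_add_left herm_prod_add_right herm_prod_scale_left herm_prod_scale_right cnj_herm_prod
    by (simp add: algebra_simps power2_eq_square)
  also have "\<dots> = of_real ((norm xd)\<^sup>2 + 2 * s * cmod ?w + s\<^sup>2 * real CARD('m))"
    unfolding fw fw' ff abab herm_prod_self[of xd] by simp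
  finally show ?thesis by (simp add: norm_sq_eq_Re_herm_prod[of "xd + _"])
qed

text \<open>The first branch records the default phase 0. Covering every realisation, the formula
  also yields measurability of the SNR.\<close>

lemma optimal_SNR_eq:
  fixes Rd :: "complex ^ 'm ^ 'm" and Rru :: "complex ^ 'n ^ 'n"
  assumes Rd: "herm_psd Rd" and ab: "\<And>i. cmod (ab $ i) = 1" and ar: "\<And>k. cmod (ar $ k) = 1"
    and pos: "\<beta>d > 0" "\<beta>br > 0" "\<beta>ru > 0"
  shows "optimal_SNR \<beta>d \<beta>br \<beta>ru \<tau> Rd Rru ab ar x y =
    (if herm_prod (psd_sqrt Rd *v ab) x = 0 then \<beta>d * (norm (psd_sqrt Rd *v x))\<^sup>2 * \<tau> else
     (\<beta>d * (norm (psd_sqrt Rd *v x))\<^sup>2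
      + 2 * sqrt (\<beta>d * \<beta>br * \<beta>ru)
        * (cmod (herm_prod (psd_sqrt Rd *v ab) x) * (\<Sum>k\<in>UNIV. cmod ((psd_sqrt Rru *v y) $ k)))
      + \<beta>br * \<beta>ru * real CARD('m) * (\<Sum>k\<in>UNIV. cmod ((psd_sqrt Rru *v y) $ k))\<^sup>2) * \<tau>)"
proof -
  let ?S = "\<Sum>k\<in>UNIV. cmod ((psd_sqrt Rru *v y) $ k)"
  define s where "s = sqrt \<beta>br * (sqrt \<beta>ru * ?S)"
  have w: "herm_prod ab (h_d \<beta>d Rd x) = of_real (sqrt \<beta>d) * herm_prod (psd_sqrt Rd *v ab) x"
    by (simp add: h_d_def herm_prod_scaleR_right herm_prod_psd_sqrt[OF Rd])
  have "(\<Sum>k\<in>UNIV. cmod (h_ru \<beta>ru Rru y $ k)) = sqrt \<beta>ru * ?S"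
    using pos by (simp add: h_ru_def sum_distrib_left)
  then have "global_channel \<beta>br ab ar (h_d \<beta>d Rd x) (h_ru \<beta>ru Rru y)
      = h_d \<beta>d Rd x + (of_real s * phase_opt ab (h_d \<beta>d Rd x)) *s ab"
    by (simp only: global_channel_eq[OF ar] s_def)
  then have snr: "optimal_SNR \<beta>d \<beta>br \<beta>ru \<tau> Rd Rru ab ar x y
      = (norm (h_d \<beta>d Rd x + (of_real s * phase_opt ab (h_d \<beta>d Rd x)) *s ab))\<^sup>2 * \<tau>"
    by (simp only: optimal_SNR_def Let_def norm_sq_eq_Re_herm_prod)
  have hd: "(norm (h_d \<beta>d Rd x))\<^sup>2 = \<beta>d * (norm (psd_sqrt Rd *v x))\<^sup>2"
    using pos by (simp add: h_d_def power_mult_distrib)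
  show ?thesis
  proof (cases "herm_prod (psd_sqrt Rd *v ab) x = 0")
    case True
    then show ?thesis by (simp add: snr w phase_opt_def hd)
  next
    case False
    then have "herm_prod ab (h_d \<beta>d Rd x) \<noteq> 0" using pos by (simp add: w)
    note n = norm_channel_sq[OF ab this, of s]
    have e1: "2 * s * cmod (herm_prod ab (h_d \<beta>d Rd x))
        = 2 * sqrt (\<beta>d * \<beta>br * \<beta>ru) * (cmod (herm_prod (psd_sqrt Rd *v ab) x) * ?S)"
      using pos by (simp add: w s_def norm_mult real_sqrt_mult)
    have e2: "s\<^sup>2 = \<beta>br * \<beta>ru * ?S\<^sup>2"
      using pos by (simp add: s_def power_mult_distrib)
    show ?thesis
      unfolding snr n hd e1 e2 using False by (simp add: mult_ac)
  qed
qed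

section \<open>Moments of the channel and the mean SNR\<close>

lemma std_gaussian_norm_psd_sqrt:
  fixes R :: "complex ^ 'm ^ 'm"
  assumes "herm_psd R" "\<And>i. R $ i $ i = 1"
  shows "has_bochner_integral std_gaussian (\<lambda>x. (norm (psd_sqrt R *v x))\<^sup>2) (real CARD('m))"
proof -
  have "has_bochner_integral std_gaussian
      (\<lambda>x. \<Sum>i\<in>UNIV. (cmod (herm_prod (psd_sqrt R *v axis i 1) x))\<^sup>2)
      (\<Sum>i\<in>(UNIV :: 'm set). (norm (psd_sqrt R *v axis i 1))\<^sup>2)"
    by (intro has_bochner_integral_sum std_gaussian_cmod_herm_prod)
  moreover have "(norm (psd_sqrt R *v x))\<^sup>2 = (\<Sum>i\<in>UNIV. (cmod (herm_prod (psd_sqrt R *v axis i 1) x))\<^sup>2)" for x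
    by (simp add: norm_vec_def L2_set_def sum_nonneg psd_sqrt_component[OF assms(1)])
  \<comment> \<open>This sum is the trace of \<open>R\<close>.\<close>
  moreover have "(\<Sum>i\<in>(UNIV :: 'm set). (norm (psd_sqrt R *v axis i 1))\<^sup>2) = real CARD('m)"
    by (simp add: norm_psd_sqrt_axis assms)
  ultimately show ?thesis by simp
qed

text \<open>Expanding the square, the diagonal contributes N through the unit mean squares, and each
  of the \<open>N * (N - 1)\<close> mixed moments lies between \<open>pi/4\<close> and 1. These
  bounds on Q carry over to the mean SNR.\<close>

lemma std_gaussian_sum_moduli:
  fixes R :: "complex ^ 'n ^ 'n"
  assumes R: "herm_psd R" "\<And>i. R $ i $ i = 1"
  defines "N \<equiv> real CARD('n)"
  shows "has_bochner_integral std_gaussian (\<lambda>y. \<Sum>k\<in>UNIV. cmod ((psd_sqrt R *v y) $ k)) (N * sqrt pi / 2)"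
    and "\<exists>Q. has_bochner_integral std_gaussian (\<lambda>y. (\<Sum>k\<in>UNIV. cmod ((psd_sqrt R *v y) $ k))\<^sup>2) Q
      \<and> N + N * (N - 1) * (pi / 4) \<le> Q \<and> Q \<le> N\<^sup>2"
proof -
  define a where "a k = psd_sqrt R *v axis k 1" for k
  have a1: "norm (a k) = 1" for k
    using norm_psd_sqrt_axis[OF R(1), of k] R(2)[of k]
    by (intro power2_eq_imp_eq[of _ 1]) (simp_all add: a_def)
  have c: "(psd_sqrt R *v y) $ k = herm_prod (a k) y" for k y
    by (simp add: a_def psd_sqrt_component[OF R(1)])
  have "has_bochner_integral std_gaussian (\<lambda>y. \<Sum>k\<in>UNIV. cmod (herm_prod (a k) y))
      (\<Sum>k\<in>(UNIV :: 'n set). norm (a k) * sqrt pi / 2)"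
    by (intro has_bochner_integral_sum std_gaussian_cmod_herm_prod)
  then show "has_bochner_integral std_gaussian (\<lambda>y. \<Sum>k\<in>UNIV. cmod ((psd_sqrt R *v y) $ k)) (N * sqrt pi / 2)"
    by (simp add: c a1 N_def)
  define q where "q i j = (\<integral>y. cmod (herm_prod (a i) y) * cmod (herm_prod (a j) y) \<partial>std_gaussian)" for i j
  define Q where "Q = (\<Sum>i\<in>UNIV. \<Sum>j\<in>UNIV. q i j)"
  have "has_bochner_integral std_gaussian
      (\<lambda>y. \<Sum>i\<in>UNIV. \<Sum>j\<in>UNIV. cmod (herm_prod (a i) y) * cmod (herm_prod (a j) y)) Q"
    unfolding Q_def q_def
    by (intro has_bochner_integral_sum has_bochner_integral_integrable std_gaussian_moduli_correlation a1)
  then have "has_bochner_integral std_gaussian (\<lambda>y. (\<Sum>k\<in>UNIV. cmod ((psd_sqrt R *v y) $ k))\<^sup>2) Q"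
    by (simp add: c power2_eq_square sum_product)
  moreover have "q i i = 1" for i
    using std_gaussian_cmod_herm_prod(2)[of "a i"]
    by (simp add: q_def has_bochner_integral_iff power2_eq_square a1)
  then have "(\<Sum>j\<in>UNIV. q i j) = 1 + (\<Sum>j\<in>UNIV - {i}. q i j)" for i
    by (subst sum.remove[of UNIV i]) auto
  then have Qs: "Q = N + (\<Sum>i\<in>UNIV. \<Sum>j\<in>UNIV - {i}. q i j)"
    by (simp add: Q_def N_def sum.distrib)
  have "(\<Sum>i\<in>(UNIV :: 'n set). \<Sum>j\<in>UNIV - {i}. pi / 4) \<le> (\<Sum>i\<in>UNIV. \<Sum>j\<in>UNIV - {i}. q i j)"
    "(\<Sum>i\<in>UNIV. \<Sum>j\<in>UNIV - {i}. q i j) \<le> (\<Sum>i\<in>(UNIV :: 'n set). \<Sum>j\<in>UNIV - {i}. 1)"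
    unfolding q_def by (intro sum_mono std_gaussian_moduli_correlation a1)+
  then have "N * (N - 1) * (pi / 4) \<le> Q - N" "Q - N \<le> N * (N - 1) * 1"
    unfolding sum_offdiag_const Qs N_def by simp_all
  then have "N + N * (N - 1) * (pi / 4) \<le> Q" "Q \<le> N\<^sup>2"
    by (simp_all add: power2_eq_square algebra_simps)
  ultimately show "\<exists>Q. has_bochner_integral std_gaussian (\<lambda>y. (\<Sum>k\<in>UNIV. cmod ((psd_sqrt R *v y) $ k))\<^sup>2) Q
      \<and> N + N * (N - 1) * (pi / 4) \<le> Q \<and> Q \<le> N\<^sup>2"
    by blast
qed

lemma expected_optimal_SNR:
  fixes P :: "'w measure" and ud :: "'w \<Rightarrow> complex ^ 'm" and uru :: "'w \<Rightarrow> complex ^ 'n"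
    and Rd :: "complex ^ 'm ^ 'm" and Rru :: "complex ^ 'n ^ 'n" and ab :: "complex ^ 'm" and ar :: "complex ^ 'n"
  defines "M \<equiv> real CARD('m)" and "N \<equiv> real CARD('n)" and "A \<equiv> norm (psd_sqrt Rd *v ab)"
  assumes P: "prob_space P" and ud: "std_complex_gaussian P ud" and uru: "std_complex_gaussian P uru"
    and indep: "indep_vectors P ud uru"
    and Rd: "herm_psd Rd" "\<And>i. Rd $ i $ i = 1" and Rru: "herm_psd Rru" "\<And>i. Rru $ i $ i = 1"
    and ab: "\<And>i. cmod (ab $ i) = 1" and ar: "\<And>k. cmod (ar $ k) = 1"
    and nz: "psd_sqrt Rd *v ab \<noteq> 0"
    and pos: "\<beta>d > 0" "\<beta>br > 0" "\<beta>ru > 0"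
  shows "\<exists>Q. (\<integral>\<omega>. optimal_SNR \<beta>d \<beta>br \<beta>ru \<tau> Rd Rru ab ar (ud \<omega>) (uru \<omega>) \<partial>P)
      = (\<beta>d * M + N * A * pi / 2 * sqrt (\<beta>d * \<beta>br * \<beta>ru) + \<beta>br * \<beta>ru * M * Q) * \<tau>
    \<and> N + N * (N - 1) * (pi / 4) \<le> Q \<and> Q \<le> N\<^sup>2"
proof -
  let ?w = "\<lambda>x. herm_prod (psd_sqrt Rd *v ab) x"
  let ?S = "\<lambda>y. \<Sum>k\<in>UNIV. cmod ((psd_sqrt Rru *v y) $ k)"
  let ?f = "\<lambda>x y. (\<beta>d * (norm (psd_sqrt Rd *v x))\<^sup>2
      + 2 * sqrt (\<beta>d * \<beta>br * \<beta>ru) * (cmod (?w x) * ?S y) + \<beta>br * \<beta>ru * M * (?S y)\<^sup>2) * \<tau>"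
  have meas [measurable]: "ud \<in> borel_measurable P" "uru \<in> borel_measurable P"
    using std_complex_gaussian_distr(1) ud uru by auto
  obtain Q where Q: "has_bochner_integral std_gaussian (\<lambda>y. (?S y)\<^sup>2) Q"
      "N + N * (N - 1) * (pi / 4) \<le> Q" "Q \<le> N\<^sup>2"
    using std_gaussian_sum_moduli(2)[OF Rru] unfolding N_def by blast
  have S: "has_bochner_integral std_gaussian ?S (N * sqrt pi / 2)"
    unfolding N_def by (rule std_gaussian_sum_moduli[OF Rru])
  have [measurable]: "?S \<in> borel_measurable borel"
    using borel_measurable_has_bochner_integral[OF S] by simp
  have W: "has_bochner_integral std_gaussian (\<lambda>x. cmod (?w x)) (A * sqrt pi / 2)"
    unfolding A_def by (rule std_gaussian_cmod_herm_prod)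
  have "has_bochner_integral P (\<lambda>\<omega>. cmod (?w (ud \<omega>)) * ?S (uru \<omega>)) (A * sqrt pi / 2 * (N * sqrt pi / 2))"
    by (rule indep_vectors_integral_mult[OF P indep meas])
      (auto intro: std_complex_gaussian_integral[OF ud W] std_complex_gaussian_integral[OF uru S])
  then have "has_bochner_integral P (\<lambda>\<omega>. ?f (ud \<omega>) (uru \<omega>))
      ((\<beta>d * M + 2 * sqrt (\<beta>d * \<beta>br * \<beta>ru) * (A * sqrt pi / 2 * (N * sqrt pi / 2)) + \<beta>br * \<beta>ru * M * Q) * \<tau>)"
    unfolding M_def
    by (intro has_bochner_integral_mult_left has_bochner_integral_add has_bochner_integral_mult_right
        std_complex_gaussian_integral[OF ud std_gaussian_norm_psd_sqrt[OF Rd]]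
        std_complex_gaussian_integral[OF uru Q(1)])
  then have int: "(\<integral>\<omega>. ?f (ud \<omega>) (uru \<omega>) \<partial>P)
      = (\<beta>d * M + 2 * sqrt (\<beta>d * \<beta>br * \<beta>ru) * (A * sqrt pi / 2 * (N * sqrt pi / 2)) + \<beta>br * \<beta>ru * M * Q) * \<tau>"
    and f_meas: "(\<lambda>\<omega>. ?f (ud \<omega>) (uru \<omega>)) \<in> borel_measurable P"
    by (auto dest: has_bochner_integral_integral_eq borel_measurable_has_bochner_integral)
  note int
  also have "2 * sqrt (\<beta>d * \<beta>br * \<beta>ru) * (A * sqrt pi / 2 * (N * sqrt pi / 2))
      = N * A * pi / 2 * sqrt (\<beta>d * \<beta>br * \<beta>ru)"
  proof -
    have "sqrt pi * sqrt pi = pi" by simp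
    then show ?thesis by (simp add: field_simps)
  qed
  finally have 1: "(\<integral>\<omega>. ?f (ud \<omega>) (uru \<omega>) \<partial>P)
      = (\<beta>d * M + N * A * pi / 2 * sqrt (\<beta>d * \<beta>br * \<beta>ru) + \<beta>br * \<beta>ru * M * Q) * \<tau>" .
  have "AE x in distr P borel ud. ?w x \<noteq> 0"
    unfolding std_complex_gaussian_distr[OF ud] by (rule AE_std_gaussian_herm_prod_nonzero[OF nz])
  then have "AE \<omega> in P. ?w (ud \<omega>) \<noteq> 0"
    by (subst (asm) AE_distr_iff) auto
  then have "AE \<omega> in P. optimal_SNR \<beta>d \<beta>br \<beta>ru \<tau> Rd Rru ab ar (ud \<omega>) (uru \<omega>) = ?f (ud \<omega>) (uru \<omega>)"
    by eventually_elim (simp add: optimal_SNR_eq[OF Rd(1) ab ar pos] M_def)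
  then have "(\<integral>\<omega>. optimal_SNR \<beta>d \<beta>br \<beta>ru \<tau> Rd Rru ab ar (ud \<omega>) (uru \<omega>) \<partial>P) = (\<integral>\<omega>. ?f (ud \<omega>) (uru \<omega>) \<partial>P)"
    using f_meas
  proof (intro integral_cong_AE)
    \<comment> \<open>Almost-everywhere equality gives equal integrals only between measurable
      functions; for the SNR this is read off from its case formula.\<close>
    have "(\<lambda>\<omega>. if ?w (ud \<omega>) = 0 then \<beta>d * (norm (psd_sqrt Rd *v ud \<omega>))\<^sup>2 * \<tau> else ?f (ud \<omega>) (uru \<omega>))
        \<in> borel_measurable P"
      using f_meas borel_measurable_has_bochner_integral[OF std_complex_gaussian_integral[OF ud
          std_gaussian_norm_psd_sqrt[OF Rd]]]
      by measurable
    then show "(\<lambda>\<omega>. optimal_SNR \<beta>d \<beta>br \<beta>ru \<tau> Rd Rru ab ar (ud \<omega>) (uru \<omega>)) \<in> borel_measurable P"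
      by (simp only: optimal_SNR_eq[OF Rd(1) ab ar pos] M_def)
  qed auto
  then show ?thesis using 1 Q by auto
qed

theorem mainTheorem4:
  fixes P :: "'w measure"
    and ud :: "'w \<Rightarrow> complex ^ 'm"
    and uru :: "'w \<Rightarrow> complex ^ 'n"
    and Rd :: "complex ^ 'm ^ 'm"
    and ab :: "complex ^ 'm"
    and ar :: "complex ^ 'n"
    and p :: "'n \<Rightarrow> 'e::euclidean_space"
    and dr \<rho>ru \<beta>d \<beta>br \<beta>ru \<tau> A M N :: real
  defines "M \<equiv> real CARD('m)"
    and "N \<equiv> real CARD('n)"
    and "A \<equiv> norm (psd_sqrt Rd *v ab)"
  assumes "prob_space P"
    and "std_complex_gaussian P ud"
    and "std_complex_gaussian P uru"
    and "indep_vectors P ud uru"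
    and "correlation_matrix Rd"
    and "inj p"
    and "nn_separation p dr"
    and "\<And>i. cmod (ab $ i) = 1"
    and "\<And>k. cmod (ar $ k) = 1"
    and "psd_sqrt Rd *v ab \<noteq> 0"
    and "\<beta>d > 0" and "\<beta>br > 0" and "\<beta>ru > 0" and "\<tau> > 0"
    and "0 \<le> \<rho>ru" and "\<rho>ru \<le> 1"
  shows "mono_on {0..1} (F_sum p dr)
    \<and> N * (N - 1) * (pi / 4) \<le> F_sum p dr \<rho>ru
    \<and> F_sum p dr \<rho>ru \<le> N * (N - 1)
    \<and> F_sum p dr 0 = N * (N - 1) * (pi / 4)
    \<and> (F_sum p dr \<longlongrightarrow> N * (N - 1)) (at_left 1)
    \<and> (\<beta>d * M + N * A * pi / 2 * sqrt (\<beta>d * \<beta>br * \<beta>ru)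
          + \<beta>br * \<beta>ru * M * (N + N * (N - 1) * (pi / 4))) * \<tau>
        \<le> (\<integral>\<omega>. optimal_SNR \<beta>d \<beta>br \<beta>ru \<tau> Rd (R_ru p dr \<rho>ru) ab ar (ud \<omega>) (uru \<omega>) \<partial>P)
    \<and> (\<integral>\<omega>. optimal_SNR \<beta>d \<beta>br \<beta>ru \<tau> Rd (R_ru p dr \<rho>ru) ab ar (ud \<omega>) (uru \<omega>) \<partial>P)
        \<le> (\<beta>d * M + N * A * pi / 2 * sqrt (\<beta>d * \<beta>br * \<beta>ru)
          + \<beta>br * \<beta>ru * M * N\<^sup>2) * \<tau>"
proof -
  have dr: "0 < dr" using \<open>nn_separation p dr\<close> by (simp add: nn_separation_def)
  have Rd: "herm_psd Rd" "\<And>i. Rd $ i $ i = 1"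
    using \<open>correlation_matrix Rd\<close> unfolding correlation_matrix_def by blast+
  have Rru: "herm_psd (R_ru p dr \<rho>ru)" "\<And>i. R_ru p dr \<rho>ru $ i $ i = 1"
    using herm_psd_R_ru R_ru_diag dr \<open>0 \<le> \<rho>ru\<close> \<open>\<rho>ru \<le> 1\<close> by blast+
  obtain Q where Q: "(\<integral>\<omega>. optimal_SNR \<beta>d \<beta>br \<beta>ru \<tau> Rd (R_ru p dr \<rho>ru) ab ar (ud \<omega>) (uru \<omega>) \<partial>P)
      = (\<beta>d * M + N * A * pi / 2 * sqrt (\<beta>d * \<beta>br * \<beta>ru) + \<beta>br * \<beta>ru * M * Q) * \<tau>"
    and Q_bounds: "N + N * (N - 1) * (pi / 4) \<le> Q" "Q \<le> N\<^sup>2"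
    unfolding M_def N_def A_def
    using expected_optimal_SNR[OF assms(4-7) Rd Rru assms(11-16), of \<tau>] by blast
  \<comment> \<open>The mean SNR is affine in Q with nonnegative slope, so the bounds on Q pass to
    it.\<close>
  have M: "0 \<le> \<beta>br * \<beta>ru * M" using \<open>\<beta>br > 0\<close> \<open>\<beta>ru > 0\<close> by (simp add: M_def)
  show ?thesis
    unfolding Q
    using F_sum_mono[OF dr, of p] F_sum_bounds[OF dr \<open>0 \<le> \<rho>ru\<close> \<open>\<rho>ru \<le> 1\<close>, of p] F_sum_0[OF dr, of p]
      F_sum_tendsto[OF dr, of p] \<open>\<tau> > 0\<close> Q_bounds M
    unfolding N_def[symmetric]
    by (intro conjI mult_right_mono add_left_mono mult_left_mono) simp_all
qed

end
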